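(* For $r\in\mathbb{N}$ (with $r \ge 1$), let \[N_r := 2^{r}\binom{r+1}{2}.\] Then, for every integer $n\ge N_r$, we have \[\lambda(r,n)=\lambda(r),\] where $\lambda(r,n)$ is the maximal relative projection constant of $r$-dimensional subspaces of $\ell_\infty^n$ and $\lambda(r)$ is the maximal absolute projection constant of $r$-dimensional real normed spaces.
   Context: All vector spaces are over $\mathbb{R}$, and $\mathbb{N}=\{1,2,\dots\}$. The space $\ell_\infty^n$ is $\mathbb{R}^n$ with the norm $\|x\|_\infty=\max_{1\le i\le n}|x_i|$. Let $X$ be a real normed space and $Y$ a linear subspace of $X$. A projection from $X$ to $Y$ is a linear map $P:X\to Y$ that is onto $Y$ and satisfies $P^2=P$ (equivalently, $P$ is linear with values in $Y$ and restricts to the identity on $Y$). The relative projection constant of $Y$ in $X$ is \[\lambda(Y,X):=\inf\{\|P\| : P \text{ is a projection from } X \text{ to } Y\},\] where $\|P\|$ is the operator norm of $P$ (unbounded projections are regarded as having norm $+\infty$). The absolute projection constant of a finite-dimensional real normed space $Y$ is \[\lambda(Y):=\sup\{\lambda(T(Y),X) : X \text{ is a real normed space and } T:Y\to X \text{ is a linear isometry (i.e. a linear isometric embedding)}\}.\] For $r,n\in\mathbb{N}$ with $n\ge r$, the maximal relative projection constant is \[\lambda(r,n):=\sup\{\lambda(Y,\ell_\infty^n) : Y \text{ is a linear subspace of } \ell_\infty^n \text{ with } \dim Y=r\},\] where $Y$ carries the norm inherited from $\ell_\infty^n$, and the maximal absolute projection constant is \[\lambda(r):=\sup\{\lambda(Y)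 : Y \text{ is a real normed space with } \dim Y=r\}.\] It is known that $\lambda(r)$ is a (finite) real number for every $r$. *)

theory Defs
  imports "HOL-Analysis.Analysis"
begin

text \<open>
  A real normed space is a pair \<open>(X, N)\<close> of a linear subspace \<open>X\<close> of an ambient real vector space
  and a norm \<open>N\<close> on \<open>X\<close>; the values of \<open>N\<close> outside \<open>X\<close> are irrelevant. The ambient type carries
  no norm of its own, it only supplies the vectors.
\<close>

definition normed_space_on :: "'a::real_vector set \<Rightarrow> ('a \<Rightarrow> real) \<Rightarrow> bool" where
  "normed_space_on X N \<longleftrightarrow> subspace X \<and>
     (\<forall>x\<in>X. 0 \<le> N x) \<and>
     (\<forall>x\<in>X. N x = 0 \<longleftrightarrow> x = 0) \<and>
     (\<forall>c. \<forall>x\<in>X. N (c *\<^sub>R x) = \<bar>c\<bar> * N x) \<and>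
     (\<forall>x\<in>X. \<forall>y\<in>X. N (x + y) \<le> N x + N y)"

definition linear_map_on :: "'a::real_vector set \<Rightarrow> ('a \<Rightarrow> 'b::real_vector) \<Rightarrow> bool" where
  "linear_map_on X f \<longleftrightarrow>
     (\<forall>x\<in>X. \<forall>y\<in>X. f (x + y) = f x + f y) \<and> (\<forall>c. \<forall>x\<in>X. f (c *\<^sub>R x) = c *\<^sub>R f x)"

definition projection_onto :: "'a::real_vector set \<Rightarrow> 'a set \<Rightarrow> ('a \<Rightarrow> 'a) \<Rightarrow> bool" where
  "projection_onto X Y P \<longleftrightarrow> linear_map_on X P \<and> P ` X = Y \<and> (\<forall>x\<in>X. P (P x) = P x)"

text \<open>
  Norms and projection constants are taken in the complete lattice \<^typ>\<open>ereal\<close>, so that unbounded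
  maps have norm \<open>\<infinity>\<close> and no supremum or infimum below depends on a boundedness side condition.
\<close>

definition operator_norm :: "'a::real_vector set \<Rightarrow> ('a \<Rightarrow> real) \<Rightarrow> ('a \<Rightarrow> 'a) \<Rightarrow> ereal" where
  "operator_norm X N P = (SUP x\<in>{x\<in>X. N x \<le> 1}. ereal (N (P x)))"

definition rel_proj_const :: "'a::real_vector set \<Rightarrow> 'a set \<Rightarrow> ('a \<Rightarrow> real) \<Rightarrow> ereal" where
  "rel_proj_const Y X N = (INF P\<in>{P. projection_onto X Y P}. operator_norm X N P)"

definition isometric_embedding ::
  "'a::real_vector set \<Rightarrow> ('a \<Rightarrow> real) \<Rightarrow> 'b::real_vector set \<Rightarrow> ('b \<Rightarrow> real) \<Rightarrow> ('a \<Rightarrow> 'b) \<Rightarrow> bool" where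
  "isometric_embedding Y M X N T \<longleftrightarrow>
     linear_map_on Y T \<and> T ` Y \<subseteq> X \<and> (\<forall>y\<in>Y. N (T y) = M y)"

text \<open>
  HOL cannot quantify over all normed spaces inside a term. In the next two definitions the type
  \<open>'v\<close> acts as a universe: normed spaces range over all pairs \<open>(X, N)\<close> with \<open>X\<close> a subspace of
  \<open>'v\<close>, that is, up to linear isometry, over all normed spaces whose algebraic dimension is at most
  that of \<open>'v\<close> (see \<open>normed_space_copy\<close> below). They are meant for infinite-dimensional \<open>'v\<close> of
  arbitrarily large dimension, and results about them should be stated for all such \<open>'v\<close>.
\<close>

definition abs_proj_const :: "'v::real_vector set \<Rightarrow> ('v \<Rightarrow> real) \<Rightarrow> ereal" where
  "abs_proj_const Y M =
     Sup {rel_proj_const (T ` Y) X N | X N (T :: 'v \<Rightarrow> 'v).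
            normed_space_on X N \<and> isometric_embedding Y M X N T}"

definition max_abs_proj_const :: "'v::real_vector itself \<Rightarrow> nat \<Rightarrow> ereal" where
  "max_abs_proj_const _ r =
     Sup {abs_proj_const Y M | (Y :: 'v set) M. normed_space_on Y M \<and> dim Y = r}"

text \<open>
  On \<^typ>\<open>real ^ 'n\<close> the library's \<^const>\<open>infnorm\<close> is the maximum norm, so
  \<open>(UNIV, infnorm)\<close> is the sup-normed space of dimension \<open>CARD('n)\<close>.
\<close>

definition max_rel_proj_const :: "'n::finite itself \<Rightarrow> nat \<Rightarrow> ereal" where
  "max_rel_proj_const _ r =
     Sup {rel_proj_const Y UNIV infnorm | Y :: (real ^ 'n) set. subspace Y \<and> dim Y = r}"

lemma infnorm_eq_Max: "infnorm (x :: real ^ 'n) = Max (range (\<lambda>i. \<bar>x $ i\<bar>))"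
proof -
  have "{\<bar>x $ i\<bar> | i. i \<in> UNIV} = range (\<lambda>i. \<bar>x $ i\<bar>)" by auto
  then show ?thesis by (simp add: infnorm_cart cSup_eq_Max)
qed

lemma normed_space_on_infnorm: "normed_space_on UNIV (infnorm :: real ^ 'n \<Rightarrow> real)"
  by (simp add: normed_space_on_def infnorm_pos_le infnorm_eq_0 infnorm_mul infnorm_triangle)

text \<open>
  A normed space of any other type has an isometric copy in the universe as soon as it embeds
  there linearly.
\<close>

lemma normed_space_copy:
  fixes f :: "'a::real_vector \<Rightarrow> 'v::real_vector"
  assumes "normed_space_on X N" and "linear f" and "inj f"
  shows "\<exists>M. normed_space_on (f ` X) M \<and> isometric_embedding X N (f ` X) M f"
proof (intro exI conjI)
  let ?M = "\<lambda>v. N (inv f v)"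
  interpret linear f by fact
  have inv: "inv f (f x) = x" for x using assms(3) by simp
  have "f x = 0 \<longleftrightarrow> x = 0" for x using assms(3) by (metis injD zero)
  moreover have "subspace (f ` X)"
    using assms(1,2) by (simp add: normed_space_on_def linear_subspace_image)
  ultimately show "normed_space_on (f ` X) ?M"
    using assms(1) inv unfolding normed_space_on_def
    by (auto simp: add[symmetric] scale[symmetric])
  show "isometric_embedding X N (f ` X) ?M f"
    by (auto simp: isometric_embedding_def linear_map_on_def add scale inv)
qed

end

theory Submission
  imports Defs
begin

text \<open>
  Encode an \<open>r\<close>-dimensional subspace of a sup-normed space by finitely many vectors \<open>v\<^sub>i \<in> \<real>\<^sup>r\<close> with
  weights \<open>m\<^sub>i \<ge> 0\<close> such that \<open>\<Sum>\<^sub>i m\<^sub>i v\<^sub>i v\<^sub>i\<^sup>T = I\<close>. Projection constants are governed by the energy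
  \<open>\<Sum>\<^sub>i\<^sub>j m\<^sub>i m\<^sub>j \<bar>\<langle>v\<^sub>i, v\<^sub>j\<rangle>\<bar>\<close>, compared with the total mass \<open>\<Sum>\<^sub>i m\<^sub>i\<close>.

  The support of such a system can be reduced: among the vectors lying, up to sign, in one orthant there
  are, as soon as they are more than \<open>(r+1 choose 2) + 1\<close>, directions \<open>d\<close> preserving mass and second
  moments. In such a direction the energy is convex, because its second order term is
  \<open>\<bar>\<Sum>\<^sub>i d\<^sub>i \<sigma>\<^sub>i v\<^sub>i\<bar>\<^sup>2\<close> for signs \<open>\<sigma>\<^sub>i\<close>, so one can move along \<open>d\<close> or \<open>-d\<close> until a weight vanishes,
  without decreasing the energy. As there are \<open>2\<^sup>r\<^sup>-\<^sup>1\<close> orthants up to sign, a support of size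
  \<open>2\<^sup>r\<^sup>-\<^sup>1 ((r+1 choose 2) + 1) \<le> 2\<^sup>r (r+1 choose 2)\<close> suffices.

  A system supported on \<open>n\<close> indices yields a subspace of the \<open>n\<close>-dimensional sup-normed space with at
  least the same projection constant, by trace duality for the invariant subspace of a signed symmetric
  matrix that maximises the trace. Conversely, a minimax argument bounds the projection constant of any
  \<open>r\<close>-dimensional space in any superspace by the energies of systems made from finitely many norming
  functionals: against given weights on the functionals, the competitor is the projection that is
  orthogonal for the corresponding weighted inner product.
\<close>

subsection \<open>Reducing the support of isotropic systems\<close>


text \<open>Vectors are families of coordinates over a set \<open>K\<close>, because the dimension
  \<open>r\<close> is a number and not a type; the index set \<open>J\<close> is likewise
  independent of \<open>'n\<close> until the support is small.\<close>

definition isotropic :: "'j set \<Rightarrow> 'k set \<Rightarrow> ('j \<Rightarrow> real) \<Rightarrow> ('j \<Rightarrow> 'k \<Rightarrow> real) \<Rightarrow> bool" where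
  "isotropic J K m v \<longleftrightarrow>
     (\<forall>k\<in>K. \<forall>l\<in>K. (\<Sum>i\<in>J. m i * (v i k * v i l)) = (if k = l then 1 else 0))"

definition energy :: "'j set \<Rightarrow> 'k set \<Rightarrow> ('j \<Rightarrow> real) \<Rightarrow> ('j \<Rightarrow> 'k \<Rightarrow> real) \<Rightarrow> real" where
  "energy J K m v = (\<Sum>i\<in>J. \<Sum>j\<in>J. m i * m j * \<bar>\<Sum>k\<in>K. v i k * v j k\<bar>)"

text \<open>Gaussian elimination: a nontrivial equation \<open>e\<close> is solved for one unknown
  \<open>p\<close> and substituted into the others, which leaves one equation and one unknown
  fewer.\<close>

lemma homogeneous_system_nontrivial_solution:
  fixes a :: "'e \<Rightarrow> 'i \<Rightarrow> real"
  assumes "finite E" "finite I" "card E < card I"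
  shows "\<exists>d. (\<exists>i\<in>I. d i \<noteq> 0) \<and> (\<forall>e\<in>E. (\<Sum>i\<in>I. d i * a e i) = 0)"
  using assms
proof (induction E arbitrary: I a rule: finite_induct)
  case empty
  then have "I \<noteq> {}" by auto
  then show ?case by (intro exI[of _ "\<lambda>_. 1"]) auto
next
  case (insert e E)
  show ?case
  proof (cases "\<forall>i\<in>I. a e i = 0")
    case True
    have "card E < card I" using insert by simp
    from insert.IH[OF insert.prems(1) this, of a] obtain d
      where "\<exists>i\<in>I. d i \<noteq> 0" "\<forall>e\<in>E. (\<Sum>i\<in>I. d i * a e i) = 0" by blast
    with True show ?thesis by (intro exI[of _ d]) auto
  next
    case False
    then obtain p where p: "p \<in> I" "a e p \<noteq> 0" by auto
    define b where "b e' i = a e' i - a e' p * a e i / a e p" for e' i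
    have "card E < card (I - {p})" using insert p by simp
    with insert.IH[of "I - {p}" b] insert.prems obtain d where
      d: "\<exists>i\<in>I - {p}. d i \<noteq> 0" "\<forall>e\<in>E. (\<Sum>i\<in>I - {p}. d i * b e i) = 0" by auto
    define s where "s = (\<Sum>i\<in>I - {p}. d i * a e i)"
    define d' where "d' = d(p := - s / a e p)"
    have split: "(\<Sum>i\<in>I. d' i * a e' i) = - s / a e p * a e' p + (\<Sum>i\<in>I - {p}. d i * a e' i)" for e'
      using p insert.prems by (subst sum.remove[of I p]) (auto simp: d'_def intro!: sum.cong)
    have "(\<Sum>i\<in>I. d' i * a e' i) = 0" if "e' \<in> E" for e'
    proof -
      have "0 = (\<Sum>i\<in>I - {p}. d i * a e' i - a e' p / a e p * (d i * a e i))"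
        using d(2) that by (auto simp: b_def algebra_simps)
      also have "\<dots> = (\<Sum>i\<in>I. d' i * a e' i)"
        unfolding split s_def sum_subtractf sum_distrib_left[symmetric] by simp
      finally show ?thesis by simp
    qed
    moreover have "(\<Sum>i\<in>I. d' i * a e i) = 0" using p by (simp add: split s_def)
    moreover have "\<exists>i\<in>I. d' i \<noteq> 0" using d(1) by (auto simp: d'_def)
    ultimately show ?thesis by (intro exI[of _ d']) auto
  qed
qed

text \<open>Counts the linear constraints in \<open>reduce_support_step\<close>: with
  \<open>card K = r\<close> there are \<open>(r + 1) choose 2\<close> second moments, and the
  successor accounts for the mass.\<close>

lemma card_subsets_le_2:
  assumes "finite K"
  shows "card {A. A \<subseteq> K \<and> card A \<le> 2} = Suc ((card K + 1) choose 2)"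
proof -
  have eq: "{A. A \<subseteq> K \<and> card A \<le> 2} =
      {A. A \<subseteq> K \<and> card A = 0} \<union> {A. A \<subseteq> K \<and> card A = 1} \<union> {A. A \<subseteq> K \<and> card A = 2}" by auto
  have "card {A. A \<subseteq> K \<and> card A \<le> 2} =
      card {A. A \<subseteq> K \<and> card A = 0} + card {A. A \<subseteq> K \<and> card A = 1} + card {A. A \<subseteq> K \<and> card A = 2}"
    unfolding eq using assms by (subst card_Un_disjoint; (auto; fail)?)+
  also have "\<dots> = Suc ((card K + 1) choose 2)"
    using assms by (simp only: n_subsets) (simp add: numeral_2_eq_2)
  finally show ?thesis .
qed

lemma large_fibre:
  assumes "finite S" "finite C" "f ` S \<subseteq> C" "card C * c < card S"
  shows "\<exists>y\<in>C. c < card {x\<in>S. f x = y}"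
proof (rule ccontr)
  assume "\<not> ?thesis"
  then have "\<forall>y\<in>C. card {x\<in>S. f x = y} \<le> c" by auto
  then have "(\<Sum>y\<in>C. card {x\<in>S. f x = y}) \<le> card C * c"
    using sum_bounded_above[of C "\<lambda>y. card {x\<in>S. f x = y}" c] by simp
  moreover have "card S = (\<Sum>y\<in>C. card {x\<in>S. f x = y})"
    using sum.group[OF assms(1-3), of "\<lambda>_. 1::nat"] by simp
  ultimately show False using assms(4) by simp
qed

text \<open>The energy is a quadratic form in the weights with symmetric kernel, so its second-order
  expansion along \<open>d\<close> is exact. The sign of the linear term can be chosen by passing to
  \<open>- d\<close>; the quadratic term is the subject of the next lemma.\<close>

lemma energy_perturb:
  assumes "finite J"
  shows "energy J K (\<lambda>i. m i + s * d i) v = energy J K m v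
     + 2 * s * (\<Sum>i\<in>J. d i * (\<Sum>j\<in>J. m j * \<bar>\<Sum>k\<in>K. v i k * v j k\<bar>)) + s\<^sup>2 * energy J K d v"
proof -
  define G where "G i j = \<bar>\<Sum>k\<in>K. v i k * v j k\<bar>" for i j
  have G: "G i j = G j i" for i j by (simp add: G_def mult.commute)
  have swap: "(\<Sum>i\<in>J. \<Sum>j\<in>J. m i * d j * G i j) = (\<Sum>i\<in>J. \<Sum>j\<in>J. d i * m j * G i j)"
    by (subst sum.swap) (simp add: G mult.commute mult.left_commute)
  have "(\<Sum>i\<in>J. \<Sum>j\<in>J. (m i + s * d i) * (m j + s * d j) * G i j) =
      (\<Sum>i\<in>J. \<Sum>j\<in>J. m i * m j * G i j + s * (d i * m j * G i j) + s * (m i * d j * G i j)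
        + s\<^sup>2 * (d i * d j * G i j))"
    by (intro sum.cong refl) (simp add: algebra_simps power2_eq_square)
  also have "\<dots> = (\<Sum>i\<in>J. \<Sum>j\<in>J. m i * m j * G i j) + 2 * s * (\<Sum>i\<in>J. \<Sum>j\<in>J. d i * m j * G i j)
      + s\<^sup>2 * (\<Sum>i\<in>J. \<Sum>j\<in>J. d i * d j * G i j)"
    by (simp only: sum.distrib sum_distrib_left[symmetric] swap)
  finally show ?thesis
    by (simp add: energy_def G_def sum_distrib_left mult.assoc)
qed

text \<open>After flipping by \<open>\<sigma>\<close>, the inner products on the support of
  \<open>d\<close> are their own absolute values. The kernel becomes a Gram matrix, and the energy
  is the squared length of the sum of the \<open>v i\<close> weighted by
  \<open>d i * \<sigma> i\<close>.\<close>

lemma energy_nonneg_if_signed: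
  assumes "finite J" "finite K"
    and sgn: "\<And>i. i \<in> J \<Longrightarrow> \<bar>\<sigma> i\<bar> = 1"
    and nonneg: "\<And>i j. i \<in> J \<Longrightarrow> j \<in> J \<Longrightarrow> d i \<noteq> 0 \<Longrightarrow> d j \<noteq> 0 \<Longrightarrow>
        0 \<le> \<sigma> i * \<sigma> j * (\<Sum>k\<in>K. v i k * v j k)"
  shows "0 \<le> energy J K d v"
proof -
  have abs: "d i * d j * \<bar>\<Sum>k\<in>K. v i k * v j k\<bar> = (\<Sum>k\<in>K. (d i * \<sigma> i * v i k) * (d j * \<sigma> j * v j k))"
    if "i \<in> J" "j \<in> J" for i j
  proof (cases "d i = 0 \<or> d j = 0")
    case False
    have "\<bar>\<Sum>k\<in>K. v i k * v j k\<bar> = \<bar>\<sigma> i * \<sigma> j * (\<Sum>k\<in>K. v i k * v j k)\<bar>"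
      using sgn that by (simp add: abs_mult)
    also have "\<dots> = \<sigma> i * \<sigma> j * (\<Sum>k\<in>K. v i k * v j k)" using nonneg that False by simp
    finally show ?thesis by (simp add: sum_distrib_left mult_ac)
  qed auto
  have "energy J K d v = (\<Sum>i\<in>J. \<Sum>j\<in>J. \<Sum>k\<in>K. (d i * \<sigma> i * v i k) * (d j * \<sigma> j * v j k))"
    by (auto simp: energy_def abs intro!: sum.cong)
  also have "\<dots> = (\<Sum>k\<in>K. (\<Sum>i\<in>J. d i * \<sigma> i * v i k)\<^sup>2)"
    unfolding power2_eq_square sum_product
    by (subst (2) sum.swap, subst sum.swap) (intro sum.cong refl)
  finally show ?thesis by (simp add: sum_nonneg)
qed

text \<open>
  Orthants are taken up to a global sign: a vector is first flipped so that its coordinate \<open>k0\<close> is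
  nonnegative. Only this halving of their number absorbs the extra mass constraint into the bound.
\<close>

definition flip_sign :: "'k \<Rightarrow> ('k \<Rightarrow> real) \<Rightarrow> real" where
  "flip_sign k0 w = (if 0 \<le> w k0 then 1 else - 1)"

definition orthant :: "'k set \<Rightarrow> 'k \<Rightarrow> ('k \<Rightarrow> real) \<Rightarrow> 'k set" where
  "orthant K k0 w = {k \<in> K - {k0}. 0 \<le> flip_sign k0 w * w k}"

text \<open>Flipped vectors of the same orthant agree in the sign of every coordinate,
  \<open>k0\<close> included because the flip itself makes it nonnegative, so each summand is
  nonnegative.\<close>

lemma same_orthant_inner_nonneg:
  assumes "orthant K k0 w = orthant K k0 w'"
  shows "0 \<le> flip_sign k0 w * flip_sign k0 w' * (\<Sum>k\<in>K. w k * w' k)"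
proof -
  have "0 \<le> (flip_sign k0 w * w k) * (flip_sign k0 w' * w' k)" if "k \<in> K" for k
  proof (cases "k = k0")
    case True
    then show ?thesis by (auto simp: flip_sign_def mult_nonpos_nonpos)
  next
    case False
    with assms that have "0 \<le> flip_sign k0 w * w k \<longleftrightarrow> 0 \<le> flip_sign k0 w' * w' k"
      by (auto simp: orthant_def set_eq_iff)
    then show ?thesis by (cases "0 \<le> flip_sign k0 w * w k") (auto intro: mult_nonneg_nonneg mult_nonpos_nonpos)
  qed
  then show ?thesis
    by (simp add: sum_distrib_left) (intro sum_nonneg, simp add: mult_ac)
qed

lemma reduce_support_step:
  fixes v :: "'j \<Rightarrow> 'k \<Rightarrow> real"
  assumes "finite J" "finite K" "K \<noteq> {}" and m: "\<And>i. i \<in> J \<Longrightarrow> 0 \<le> m i"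
    and iso: "isotropic J K m v"
    and large: "2 ^ card K * ((card K + 1) choose 2) < card {i\<in>J. m i \<noteq> 0}"
  obtains m' where "\<And>i. i \<in> J \<Longrightarrow> 0 \<le> m' i" "isotropic J K m' v" "sum m' J = sum m J"
    "energy J K m v \<le> energy J K m' v" "card {i\<in>J. m' i \<noteq> 0} < card {i\<in>J. m i \<noteq> 0}"
proof -
  let ?S = "{i\<in>J. m i \<noteq> 0}"
  define c where "c = (card K + 1) choose 2"
  obtain k0 where k0: "k0 \<in> K" using assms(3) by blast
  have "card K \<noteq> 0" using k0 assms(2) by auto
  then have "2 \<le> card K + 1" by simp
  then have "1 \<le> c" unfolding c_def by (metis One_nat_def Suc_leI zero_less_binomial)
  \<comment> \<open>\<open>Suc c\<close> is the number of linear constraints. It is at most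
    \<open>2 * c\<close> as \<open>1 \<le> c\<close>, and the factor 2 is recovered from counting
    orthants up to sign.\<close>
  have "card (Pow (K - {k0})) * Suc c \<le> 2 ^ (card K - 1) * (2 * c)"
    using assms(2) k0 \<open>1 \<le> c\<close> by (simp add: card_Pow)
  also have "\<dots> = 2 ^ card K * c"
    using \<open>card K \<noteq> 0\<close> by (cases "card K") auto
  finally have "card (Pow (K - {k0})) * Suc c < card ?S" using large by (simp only: c_def)
  moreover have "(\<lambda>i. orthant K k0 (v i)) ` ?S \<subseteq> Pow (K - {k0})" by (auto simp: orthant_def)
  ultimately have "\<exists>Q\<in>Pow (K - {k0}). Suc c < card {i\<in>?S. orthant K k0 (v i) = Q}"
    using assms(1,2) by (intro large_fibre) auto
  then obtain Q where Q: "Suc c < card {i\<in>?S. orthant K k0 (v i) = Q}" ..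
  define I where "I = {i\<in>?S. orthant K k0 (v i) = Q}"
  have I: "finite I" "I \<subseteq> J" using assms(1) by (auto simp: I_def)
  define E where "E = {A. A \<subseteq> K \<and> card A \<le> 2}"
  \<comment> \<open>The set \<open>{}\<close> encodes the mass constraint, \<open>{k, l}\<close> the second moment of the coordinates \<open>k\<close>, \<open>l\<close>.\<close>
  define a where "a A i = (if card A = 1 then (\<Prod>k\<in>A. v i k)\<^sup>2 else (\<Prod>k\<in>A. v i k))" for A i
  have "finite E" using assms(2) by (auto simp: E_def)
  moreover have "card E < card I" using Q assms(2) by (simp only: E_def I_def card_subsets_le_2 c_def)
  ultimately obtain d0 where d0: "\<exists>i\<in>I. d0 i \<noteq> 0" "\<forall>A\<in>E. (\<Sum>i\<in>I. d0 i * a A i) = 0"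
    using homogeneous_system_nontrivial_solution[OF _ I(1), of E a] by blast
  \<comment> \<open>\<open>f\<close> is half the gradient of the energy at \<open>m\<close>. Both
    \<open>d0\<close> and \<open>- d0\<close> satisfy the constraints, and \<open>\<epsilon>\<close>
    selects one along which the energy does not decrease to first order.\<close>
  define f where "f i = (\<Sum>j\<in>J. m j * \<bar>\<Sum>k\<in>K. v i k * v j k\<bar>)" for i
  define \<epsilon> :: real where "\<epsilon> = (if 0 \<le> (\<Sum>i\<in>I. d0 i * f i) then 1 else - 1)"
  define d where "d i = (if i \<in> I then \<epsilon> * d0 i else 0)" for i
  have \<epsilon>: "\<epsilon> \<noteq> 0" by (simp add: \<epsilon>_def)
  have sumd: "(\<Sum>i\<in>J. d i * g i) = \<epsilon> * (\<Sum>i\<in>I. d0 i * g i)" for g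
  proof -
    have "(\<Sum>i\<in>J. d i * g i) = (\<Sum>i\<in>I. d i * g i)"
      using I assms(1) by (intro sum.mono_neutral_right) (auto simp: d_def)
    then show ?thesis by (simp add: d_def sum_distrib_left mult.assoc)
  qed
  have "{} \<in> E" by (simp add: E_def)
  with d0 have "(\<Sum>i\<in>I. d0 i) = 0" by (fastforce simp: a_def)
  then have d_sum: "sum d J = 0" using sumd[of "\<lambda>_. 1"] by simp
  have d_moment: "(\<Sum>i\<in>J. d i * (v i k * v i l)) = 0" if "k \<in> K" "l \<in> K" for k l
  proof -
    have "{k, l} \<in> E" using that by (simp add: E_def card_insert_if)
    then have "(\<Sum>i\<in>I. d0 i * a {k, l} i) = 0" using d0(2) by blast
    moreover have "a {k, l} i = v i k * v i l" for i
      by (cases "k = l") (simp_all add: a_def power2_eq_square)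
    ultimately show ?thesis unfolding sumd by simp
  qed
  have d_f: "0 \<le> (\<Sum>i\<in>J. d i * f i)" by (simp add: sumd \<epsilon>_def)
  have d_quad: "0 \<le> energy J K d v"
  proof (rule energy_nonneg_if_signed[where \<sigma> = "\<lambda>i. flip_sign k0 (v i)"])
    fix i j assume "d i \<noteq> 0" "d j \<noteq> 0"
    then have "i \<in> I" "j \<in> I" by (auto simp: d_def split: if_splits)
    then show "0 \<le> flip_sign k0 (v i) * flip_sign k0 (v j) * (\<Sum>k\<in>K. v i k * v j k)"
      by (intro same_orthant_inner_nonneg) (simp add: I_def)
  qed (use assms in \<open>auto simp: flip_sign_def\<close>)
  define N where "N = {i\<in>J. d i < 0}"
  \<comment> \<open>A nonzero direction whose entries sum to zero has a negative entry, so moving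
    along \<open>d\<close> must eventually exhaust a weight.\<close>
  have "N \<noteq> {}"
  proof
    assume "N = {}"
    then have "\<forall>i\<in>J. 0 \<le> d i" by (auto simp: N_def not_less)
    then have "\<forall>i\<in>J. d i = 0" using d_sum assms(1) by (simp add: sum_nonneg_eq_0_iff)
    moreover obtain i where "i \<in> I" "d0 i \<noteq> 0" using d0(1) by blast
    ultimately show False using I(2) \<epsilon> by (force simp: d_def)
  qed
  have finN: "finite N" using assms(1) by (simp add: N_def)
  \<comment> \<open>The largest step that keeps all weights nonnegative; the index attaining the
    minimum loses its weight.\<close>
  define s where "s = Min ((\<lambda>i. m i / - d i) ` N)"
  have "s \<in> (\<lambda>i. m i / - d i) ` N" unfolding s_def using finN \<open>N \<noteq> {}\<close> by (intro Min_in) auto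
  then obtain p where p: "p \<in> N" "s = m p / - d p" by auto
  have s_le: "s \<le> m i / - d i" if "i \<in> N" for i
    unfolding s_def using that finN by (intro Min_le) auto
  have s0: "0 \<le> s" using p m by (auto simp: N_def intro!: divide_nonneg_neg)
  define m' where "m' i = m i + s * d i" for i
  have sub: "{i\<in>J. m' i \<noteq> 0} \<subseteq> ?S - {p}"
  proof
    fix i assume i: "i \<in> {i\<in>J. m' i \<noteq> 0}"
    have "m i \<noteq> 0" using i by (auto simp: m'_def d_def I_def split: if_splits)
    moreover have "i \<noteq> p" using i p by (auto simp: m'_def N_def)
    ultimately show "i \<in> ?S - {p}" using i by simp
  qed
  have "p \<in> ?S" using p by (auto simp: N_def d_def I_def split: if_splits)
  show ?thesis
  proof (rule that[of m'])
    show "0 \<le> m' i" if "i \<in> J" for i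
    proof (cases "d i < 0")
      case True
      then have "s \<le> m i / - d i" using s_le that by (simp add: N_def)
      then show ?thesis using True by (simp add: m'_def field_simps)
    next
      case False
      then show ?thesis using m that s0 by (simp add: m'_def)
    qed
    show "isotropic J K m' v"
      using iso d_moment
      by (simp add: isotropic_def m'_def distrib_right sum.distrib mult.assoc sum_distrib_left[symmetric])
    show "sum m' J = sum m J"
      using d_sum by (simp add: m'_def sum.distrib sum_distrib_left[symmetric])
    show "energy J K m v \<le> energy J K m' v"
      using d_f d_quad s0 unfolding m'_def energy_perturb[OF assms(1)] f_def by simp
    show "card {i\<in>J. m' i \<noteq> 0} < card ?S"
      using sub \<open>p \<in> ?S\<close> assms(1) by (intro psubset_card_mono) auto
  qed
qed

lemma reduce_support:
  fixes v :: "'j \<Rightarrow> 'k \<Rightarrow> real"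
  assumes "finite J" "finite K" "K \<noteq> {}" "\<And>i. i \<in> J \<Longrightarrow> 0 \<le> m i" "isotropic J K m v"
  shows "\<exists>m'. (\<forall>i\<in>J. 0 \<le> m' i) \<and> isotropic J K m' v \<and> sum m' J = sum m J \<and>
    energy J K m v \<le> energy J K m' v \<and>
    card {i\<in>J. m' i \<noteq> 0} \<le> 2 ^ card K * ((card K + 1) choose 2)"
  using assms(4,5)
proof (induction "card {i\<in>J. m i \<noteq> 0}" arbitrary: m rule: less_induct)
  case less
  show ?case
  proof (cases "card {i\<in>J. m i \<noteq> 0} \<le> 2 ^ card K * ((card K + 1) choose 2)")
    case True
    then show ?thesis using less.prems by (intro exI[of _ m]) auto
  next
    case False
    then have "2 ^ card K * ((card K + 1) choose 2) < card {i\<in>J. m i \<noteq> 0}" by (rule not_le_imp_less)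
    from reduce_support_step[OF assms(1-3) less.prems this]
    obtain m' where m': "\<And>i. i \<in> J \<Longrightarrow> 0 \<le> m' i" "isotropic J K m' v" "sum m' J = sum m J"
      "energy J K m v \<le> energy J K m' v" "card {i\<in>J. m' i \<noteq> 0} < card {i\<in>J. m i \<noteq> 0}"
      by blast
    from less.hyps[OF m'(5,1,2)] obtain m'' where
      "\<forall>i\<in>J. 0 \<le> m'' i" "isotropic J K m'' v" "sum m'' J = sum m' J"
      "energy J K m' v \<le> energy J K m'' v"
      "card {i\<in>J. m'' i \<noteq> 0} \<le> 2 ^ card K * ((card K + 1) choose 2)" by blast
    with m'(3,4) show ?thesis by (intro exI[of _ m'']) auto
  qed
qed

subsection \<open>Lower bounds by trace duality\<close>

definition orthonormal_on :: "'k set \<Rightarrow> ('k \<Rightarrow> 'a::real_inner) \<Rightarrow> bool" where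
  "orthonormal_on K x \<longleftrightarrow> (\<forall>k\<in>K. \<forall>l\<in>K. x k \<bullet> x l = (if k = l then 1 else 0))"

text \<open>Compactness. Systems are stored as matrices whose rows outside \<open>K\<close> are
  zero, since free rows would make the set unbounded; the given \<open>x\<close> shows that it is
  nonempty.\<close>

lemma orthonormal_trace_maximiser:
  fixes x :: "'n::finite \<Rightarrow> real ^ 'n" and M :: "real ^ 'n ^ 'n"
  assumes "orthonormal_on K x"
  obtains y where "orthonormal_on K y"
    "\<And>z :: 'n \<Rightarrow> real ^ 'n. orthonormal_on K z \<Longrightarrow>
      (\<Sum>k\<in>K. z k \<bullet> (M *v z k)) \<le> (\<Sum>k\<in>K. y k \<bullet> (M *v y k))"
proof -
  define C :: "(real ^ 'n ^ 'n) set" where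
    "C = {X. (\<forall>k l. k \<in> K \<longrightarrow> l \<in> K \<longrightarrow> X $ k \<bullet> X $ l = (if k = l then 1 else 0)) \<and> (\<forall>k. k \<notin> K \<longrightarrow> X $ k = 0)}"
  define F :: "real ^ 'n ^ 'n \<Rightarrow> real" where "F X = (\<Sum>k\<in>K. X $ k \<bullet> (M *v (X $ k)))" for X
  define pad :: "('n \<Rightarrow> real ^ 'n) \<Rightarrow> real ^ 'n ^ 'n" where "pad z = (\<chi> k. if k \<in> K then z k else 0)" for z
  have pad_C: "pad z \<in> C" if "orthonormal_on K z" for z
    using that by (auto simp: C_def pad_def orthonormal_on_def)
  have F_pad: "F (pad z) = (\<Sum>k\<in>K. z k \<bullet> (M *v z k))" for z
    by (auto simp: F_def pad_def intro!: sum.cong)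
  have "closed C" unfolding C_def
    by (intro closed_Collect_conj closed_Collect_all closed_Collect_imp closed_Collect_eq
        continuous_intros) auto
  moreover have "bounded C"
  proof (rule boundedI)
    fix X assume X: "X \<in> C"
    have "norm (X $ k) \<le> 1" for k
      using X by (cases "k \<in> K") (auto simp: C_def norm_eq_sqrt_inner)
    then have "(\<Sum>k\<in>UNIV. norm (X $ k)) \<le> (\<Sum>k\<in>(UNIV :: 'n set). 1)" by (intro sum_mono) auto
    moreover have "norm X \<le> (\<Sum>k\<in>UNIV. norm (X $ k))"
      unfolding norm_vec_def by (rule L2_set_le_sum) simp
    ultimately show "norm X \<le> real CARD('n)" by simp
  qed
  ultimately have "compact C" by (simp add: compact_eq_bounded_closed)
  moreover have "continuous_on C F" unfolding F_def
    by (intro continuous_intros bounded_linear.continuous_on[OF matrix_vector_mul_bounded_linear])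
  ultimately obtain X where X: "X \<in> C" "\<And>Z. Z \<in> C \<Longrightarrow> F Z \<le> F X"
    using continuous_attains_sup[of C F] pad_C[OF assms] by blast
  show ?thesis
  proof (rule that[of "\<lambda>k. X $ k"])
    show "orthonormal_on K (\<lambda>k. X $ k)" using X(1) by (simp add: C_def orthonormal_on_def)
    show "(\<Sum>k\<in>K. z k \<bullet> (M *v z k)) \<le> (\<Sum>k\<in>K. X $ k \<bullet> (M *v X $ k))"
      if "orthonormal_on K z" for z :: "'n \<Rightarrow> real ^ 'n"
      using X(2)[OF pad_C[OF that]] unfolding F_pad by (simp add: F_def)
  qed
qed

lemma linear_term_zero_if_quadratic_nonpos:
  fixes b d :: real
  assumes "\<And>s. 2 * s * b + s\<^sup>2 * d \<le> 0"
  shows "b = 0"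
proof (rule ccontr)
  assume "b \<noteq> 0"
  \<comment> \<open>At \<open>s = b / D\<close> the linear term outweighs the quadratic one, because
    \<open>2 * D + d\<close> is positive.\<close>
  define D where "D = \<bar>d\<bar> + 1"
  have D: "D > 0" "2 * D + d > 0" by (auto simp: D_def)
  have "2 * (b / D) * b + (b / D)\<^sup>2 * d = b\<^sup>2 / D\<^sup>2 * (2 * D + d)"
    using D by (simp add: field_simps power2_eq_square)
  moreover have "b\<^sup>2 / D\<^sup>2 * (2 * D + d) > 0" using D \<open>b \<noteq> 0\<close> by simp
  ultimately show False using assms[of "b / D"] by simp
qed

text \<open>First-order optimality: replacing \<open>x k\<close> by the normalisation of
  \<open>x k + s *\<^sub>R y\<close>, for a unit vector \<open>y\<close> orthogonal to the system,
  cannot raise the trace for either sign of \<open>s\<close>. Hence \<open>M *v x k\<close> has no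
  component orthogonal to the system.\<close>

lemma maximiser_invariant:
  fixes x :: "'n::finite \<Rightarrow> real ^ 'n" and M :: "real ^ 'n ^ 'n"
  assumes sym: "\<And>v w. v \<bullet> (M *v w) = (M *v v) \<bullet> w"
    and orth: "orthonormal_on K x"
    and max: "\<And>z :: 'n \<Rightarrow> real ^ 'n. orthonormal_on K z \<Longrightarrow>
      (\<Sum>k\<in>K. z k \<bullet> (M *v z k)) \<le> (\<Sum>k\<in>K. x k \<bullet> (M *v x k))"
    and k: "k \<in> K"
  shows "M *v x k = (\<Sum>l\<in>K. (x l \<bullet> (M *v x k)) *\<^sub>R x l)"
proof -
  have perp: "x k \<bullet> (M *v y) = 0" if y: "\<And>l. l \<in> K \<Longrightarrow> x l \<bullet> y = 0" and "norm y = 1" for y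
  proof (rule linear_term_zero_if_quadratic_nonpos)
    fix s :: real
    let ?a = "x k \<bullet> (M *v x k)" and ?b = "x k \<bullet> (M *v y)" and ?c = "y \<bullet> (M *v y)"
    have yy: "y \<bullet> y = 1" using \<open>norm y = 1\<close> by (simp add: norm_eq_1)
    have ba: "y \<bullet> (M *v x k) = ?b" by (metis sym inner_commute)
    have pos: "1 + s\<^sup>2 > 0" by (simp add: add_pos_nonneg)
    define u where "u = (1 / sqrt (1 + s\<^sup>2)) *\<^sub>R (x k + s *\<^sub>R y)"
    have sq: "(1 / sqrt (1 + s\<^sup>2)) * (1 / sqrt (1 + s\<^sup>2)) = 1 / (1 + s\<^sup>2)" using pos by simp
    have xl: "x l \<bullet> x l = 1" "x l \<bullet> y = 0" "y \<bullet> x l = 0" if "l \<in> K" for l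
      using orth y that by (auto simp: orthonormal_on_def inner_commute)
    have "orthonormal_on K (x(k := u))"
    proof -
      have "(x k + s *\<^sub>R y) \<bullet> (x k + s *\<^sub>R y) = 1 + s\<^sup>2"
        using xl[OF k] yy by (simp add: inner_add inner_commute power2_eq_square)
      then have "u \<bullet> u = 1"
        unfolding u_def inner_scaleR_left inner_scaleR_right mult.assoc[symmetric] sq
        using pos by simp
      moreover have "u \<bullet> x l = 0" "x l \<bullet> u = 0" if "l \<in> K" "l \<noteq> k" for l
        using orth k that xl by (auto simp: orthonormal_on_def u_def inner_add)
      ultimately show ?thesis using orth by (auto simp: orthonormal_on_def)
    qed
    from max[OF this] have "u \<bullet> (M *v u) \<le> ?a"
      using k by (simp add: sum.remove[of K k])
    moreover have "u \<bullet> (M *v u) = (?a + 2 * s * ?b + s\<^sup>2 * ?c) / (1 + s\<^sup>2)"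
      unfolding u_def matrix_vector_mult_scaleR inner_scaleR_left inner_scaleR_right mult.assoc[symmetric] sq
      by (simp add: matrix_vector_right_distrib matrix_vector_mult_scaleR inner_add ba power2_eq_square
          algebra_simps add_divide_distrib)
    ultimately have "?a + 2 * s * ?b + s\<^sup>2 * ?c \<le> ?a * (1 + s\<^sup>2)"
      using pos by (simp add: pos_divide_le_eq)
    then show "2 * s * ?b + s\<^sup>2 * (?c - ?a) \<le> 0" by (simp add: algebra_simps)
  qed
  define w where "w = M *v x k - (\<Sum>l\<in>K. (x l \<bullet> (M *v x k)) *\<^sub>R x l)"
  have w: "x l \<bullet> w = 0" if "l \<in> K" for l
  proof -
    have "x l \<bullet> (\<Sum>l'\<in>K. (x l' \<bullet> (M *v x k)) *\<^sub>R x l') = (\<Sum>l'\<in>K. if l = l' then x l' \<bullet> (M *v x k) else 0)"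
      using orth that unfolding inner_sum_right orthonormal_on_def by (intro sum.cong) auto
    then show ?thesis using that by (simp add: w_def inner_diff_right)
  qed
  have "w = 0"
  proof (rule ccontr)
    assume "w \<noteq> 0"
    then have "x k \<bullet> (M *v ((1 / norm w) *\<^sub>R w)) = 0"
      using w by (intro perp) (auto simp: norm_eq_sqrt_inner)
    then have "(M *v x k) \<bullet> w = 0" using \<open>w \<noteq> 0\<close> by (simp add: matrix_vector_mult_scaleR sym[symmetric])
    moreover have "(\<Sum>l\<in>K. (x l \<bullet> (M *v x k)) *\<^sub>R x l) \<bullet> w = 0" using w by (simp add: inner_sum_left)
    ultimately have "w \<bullet> w = 0" by (subst w_def) (simp add: inner_diff_left)
    with \<open>w \<noteq> 0\<close> show False by simp
  qed
  then show ?thesis by (simp add: w_def)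
qed

section \<open>Row sums, invariant subspaces and the trace bound\<close>

lemma row_sum_le_operator_norm:
  fixes P :: "real ^ 'n \<Rightarrow> real ^ 'n"
  assumes "linear P"
  shows "ereal (\<Sum>i\<in>UNIV. \<bar>P (axis i 1) $ j\<bar>) \<le> operator_norm UNIV infnorm P"
proof -
  \<comment> \<open>The test vector carries the signs of row \<open>j\<close> of the matrix of
    \<open>P\<close>, so that coordinate \<open>j\<close> of \<open>P s\<close> is the absolute row
    sum.\<close>
  define s :: "real ^ 'n" where "s = (\<chi> i. sgn (P (axis i 1) $ j))"
  have "P s = (\<Sum>i\<in>UNIV. (s $ i) *\<^sub>R P (axis i 1))"
    by (subst basis_expansion[of s, symmetric])
      (simp add: linear_sum[OF assms] linear_cmul[OF assms] scalar_mult_eq_scaleR)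
  then have "P s $ j = (\<Sum>i\<in>UNIV. \<bar>P (axis i 1) $ j\<bar>)"
    by (simp add: s_def abs_sgn mult.commute)
  moreover have "\<bar>P s $ j\<bar> \<le> infnorm (P s)" by (simp add: component_le_infnorm_cart)
  moreover have "infnorm s \<le> 1" by (auto simp: infnorm_eq_Max s_def sgn_if)
  ultimately show ?thesis
    unfolding operator_norm_def by (intro SUP_upper2[of s]) auto
qed

lemma sum_rotate:
  "(\<Sum>k\<in>A. \<Sum>i\<in>B. \<Sum>j\<in>C. f k i j) = (\<Sum>i\<in>B. \<Sum>j\<in>C. \<Sum>k\<in>A. f k i j)"
proof -
  have "(\<Sum>k\<in>A. \<Sum>i\<in>B. \<Sum>j\<in>C. f k i j) = (\<Sum>i\<in>B. \<Sum>k\<in>A. \<Sum>j\<in>C. f k i j)"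
    by (rule sum.swap)
  also have "\<dots> = (\<Sum>i\<in>B. \<Sum>j\<in>C. \<Sum>k\<in>A. f k i j)"
    by (intro sum.cong refl sum.swap)
  finally show ?thesis .
qed

lemma biorthogonal_expansion:
  fixes b :: "'k \<Rightarrow> 'v::real_vector" and c :: "'k \<Rightarrow> 'v \<Rightarrow> real"
  assumes lin: "\<And>k. linear (c k)" and "finite K"
    and dual: "\<And>k l. k \<in> K \<Longrightarrow> l \<in> K \<Longrightarrow> c k (b l) = (if k = l then 1 else 0)"
    and "z \<in> span (b ` K)"
  shows "z = (\<Sum>k\<in>K. c k z *\<^sub>R b k)"
  using assms(4)
proof (induction rule: span_induct_alt)
  case base
  then show ?case by (simp add: linear_0[OF lin])
next
  case (step a y w)
  then obtain l where l: "l \<in> K" "y = b l" by auto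
  have "(\<Sum>k\<in>K. c k (a *\<^sub>R y + w) *\<^sub>R b k) = a *\<^sub>R (\<Sum>k\<in>K. c k y *\<^sub>R b k) + w"
    by (subst (2) step.IH)
      (simp add: linear_add[OF lin] linear_cmul[OF lin] scaleR_add_left sum.distrib scaleR_sum_right)
  also have "(\<Sum>k\<in>K. c k y *\<^sub>R b k) = (\<Sum>k\<in>K. if k = l then b k else 0)"
    using l dual by (intro sum.cong) auto
  finally show ?case using l assms(2) by simp
qed

text \<open>With \<open>D = diag t\<close>, the choice of the signs \<open>S\<close> makes the
  left-hand sum the trace of \<open>M = D S D\<close> on the span of \<open>x\<close>. The subspace
  \<open>Y\<close> is the inverse of \<open>D\<close> applied to the span of a system
  \<open>y\<close> that maximises this trace. For each projection \<open>P\<close> onto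
  \<open>Y\<close> the trace of \<open>S D^2 P\<close> is the maximal one, while it is at most the
  sum of the absolute row sums of \<open>P\<close> weighted by the squares of
  \<open>t\<close>.\<close>

lemma projection_bound_of_orthonormal:
  fixes x :: "'n::finite \<Rightarrow> real ^ 'n" and t :: "'n \<Rightarrow> real"
  assumes orth: "orthonormal_on K x" and t: "\<And>i. 0 < t i"
  obtains Y :: "(real ^ 'n) set" where "subspace Y" "dim Y = card K"
    "\<And>P. projection_onto UNIV Y P \<Longrightarrow>
      ereal (\<Sum>i\<in>UNIV. \<Sum>j\<in>UNIV. t i * t j * \<bar>\<Sum>k\<in>K. x k $ i * x k $ j\<bar>)
        \<le> ereal (\<Sum>i\<in>UNIV. (t i)\<^sup>2) * operator_norm UNIV infnorm P"
proof -
  define S where "S i j = sgn (\<Sum>k\<in>K. x k $ i * x k $ j)" for i j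
  define M :: "real ^ 'n ^ 'n" where "M = (\<chi> i j. t i * S i j * t j)"
  have S: "S i j = S j i" "\<bar>S i j\<bar> \<le> 1" for i j by (auto simp: S_def mult.commute sgn_if)
  have M_form: "v \<bullet> (M *v w) = (\<Sum>i\<in>UNIV. \<Sum>j\<in>UNIV. t i * t j * (S i j * (v $ i * w $ j)))" for v w
    by (simp add: inner_vec_def matrix_vector_mult_def M_def sum_distrib_left mult_ac)
  have sym: "v \<bullet> (M *v w) = (M *v v) \<bullet> w" for v w
    unfolding inner_commute[of "M *v v" w] M_form
    by (subst sum.swap) (simp add: S(1) mult_ac)
  have start: "(\<Sum>k\<in>K. x k \<bullet> (M *v x k)) =
      (\<Sum>i\<in>UNIV. \<Sum>j\<in>UNIV. t i * t j * \<bar>\<Sum>k\<in>K. x k $ i * x k $ j\<bar>)"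
  proof -
    have "(\<Sum>k\<in>K. x k \<bullet> (M *v x k)) =
        (\<Sum>i\<in>UNIV. \<Sum>j\<in>UNIV. \<Sum>k\<in>K. t i * t j * (S i j * (x k $ i * x k $ j)))"
      unfolding M_form by (rule sum_rotate)
    also have "\<dots> = (\<Sum>i\<in>UNIV. \<Sum>j\<in>UNIV. t i * t j * (S i j * (\<Sum>k\<in>K. x k $ i * x k $ j)))"
      by (simp only: sum_distrib_left)
    finally show ?thesis by (simp add: S_def abs_sgn mult.commute)
  qed
  obtain y where y: "orthonormal_on K y" and max: "\<And>z :: 'n \<Rightarrow> real ^ 'n. orthonormal_on K z \<Longrightarrow>
      (\<Sum>k\<in>K. z k \<bullet> (M *v z k)) \<le> (\<Sum>k\<in>K. y k \<bullet> (M *v y k))"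
    using orthonormal_trace_maximiser[OF orth] by blast
  have inv: "M *v y k = (\<Sum>l\<in>K. (y l \<bullet> (M *v y k)) *\<^sub>R y l)" if "k \<in> K" for k
    by (rule maximiser_invariant[OF sym y _ that]) (rule max)
  \<comment> \<open>\<open>b\<close> is the basis of \<open>Y\<close> obtained from \<open>y\<close>
    by dividing coordinates by \<open>t\<close>; the functionals \<open>c\<close>, which multiply by
    \<open>t\<close> and pair with \<open>y\<close>, are dual to it.\<close>
  define b :: "'n \<Rightarrow> real ^ 'n" where "b k = (\<chi> i. y k $ i / t i)" for k
  define c :: "'n \<Rightarrow> real ^ 'n \<Rightarrow> real" where "c l w = (\<Sum>j\<in>UNIV. t j * y l $ j * w $ j)" for l w
  have c_lin: "linear (c l)" for l
    unfolding c_def by (intro linearI) (simp_all add: algebra_simps sum.distrib sum_distrib_left)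
  have c_b: "c l (b k) = (if l = k then 1 else 0)" if "k \<in> K" "l \<in> K" for k l
  proof -
    have "c l (b k) = y l \<bullet> y k"
      unfolding c_def b_def inner_vec_def using t by (intro sum.cong) (simp_all add: less_imp_neq[symmetric])
    then show ?thesis using y that by (simp add: orthonormal_on_def)
  qed
  define Y where "Y = span (b ` K)"
  have expand: "w = (\<Sum>k\<in>K. c k w *\<^sub>R b k)" if "w \<in> Y" for w
    using that unfolding Y_def by (intro biorthogonal_expansion) (auto simp: c_lin c_b)
  have inj: "inj_on b K"
    by (rule inj_onI) (metis c_b zero_neq_one)
  have indep: "independent (b ` K)"
  proof (rule independent_if_scalars_zero)
    fix f z assume f: "(\<Sum>w\<in>b ` K. f w *\<^sub>R w) = 0" and "z \<in> b ` K"
    then obtain l where l: "l \<in> K" "z = b l" by auto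
    have "0 = c l (\<Sum>k\<in>K. f (b k) *\<^sub>R b k)"
      using f by (simp add: sum.reindex[OF inj] linear_0[OF c_lin])
    also have "\<dots> = (\<Sum>k\<in>K. if k = l then f (b k) else 0)"
      unfolding linear_sum[OF c_lin] linear_cmul[OF c_lin] using l by (intro sum.cong) (auto simp: c_b)
    finally show "f z = 0" using l by simp
  qed simp
  show ?thesis
  proof (rule that[of Y])
    show "subspace Y" by (simp add: Y_def)
    show "dim Y = card K" using indep by (simp add: Y_def dim_span dim_eq_card_independent card_image[OF inj])
    fix P assume P: "projection_onto UNIV Y P"
    then have lin: "linear P"
      by (intro linearI) (simp_all add: projection_onto_def linear_map_on_def)
    have PY: "P w \<in> Y" for w using P by (auto simp: projection_onto_def)
    have Pid: "P w = w" if "w \<in> Y" for w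
      using P that unfolding projection_onto_def by blast
    define g where "g k i = c k (P (axis i 1))" for k i
    have Pe: "P (axis i 1) $ j = (\<Sum>k\<in>K. g k i * (y k $ j / t j))" for i j
      using arg_cong[OF expand[OF PY, of "axis i 1"], of "\<lambda>w. w $ j"] by (simp add: g_def b_def)
    \<comment> \<open>In coordinates this is \<open>P (b l) = b l\<close>, which makes the trace
      independent of \<open>P\<close>.\<close>
    have g_b: "(\<Sum>i\<in>UNIV. g k i * (y l $ i / t i)) = (if k = l then 1 else 0)" if "k \<in> K" "l \<in> K" for k l
    proof -
      have "b l = (\<Sum>i\<in>UNIV. (b l $ i) *\<^sub>R axis i 1)"
        using basis_expansion[of "b l"] by (simp add: scalar_mult_eq_scaleR)
      then have "c k (P (b l)) = c k (P (\<Sum>i\<in>UNIV. (b l $ i) *\<^sub>R axis i 1))" by metis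
      also have "\<dots> = (\<Sum>i\<in>UNIV. g k i * (y l $ i / t i))"
        by (simp add: linear_sum[OF lin] linear_cmul[OF lin] linear_sum[OF c_lin] linear_cmul[OF c_lin]
            g_def b_def mult.commute)
      finally show ?thesis using Pid[of "b l"] c_b[OF that(2,1)] that by (simp add: Y_def span_base)
    qed
    \<comment> \<open>Invariance of the span of \<open>y\<close> under \<open>M\<close>, divided by
      \<open>t i\<close>: it expresses the image of \<open>b k\<close> under \<open>S D^2\<close>
      through the \<open>b l\<close>.\<close>
    have Mx: "(\<Sum>j\<in>UNIV. S i j * t j * y k $ j) = (\<Sum>l\<in>K. (y l \<bullet> (M *v y k)) * (y l $ i / t i))"
      if "k \<in> K" for i k
    proof -
      have "t i * (\<Sum>j\<in>UNIV. S i j * t j * y k $ j) = (M *v y k) $ i"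
        by (simp add: matrix_vector_mult_def M_def sum_distrib_left mult_ac)
      also have "\<dots> = (\<Sum>l\<in>K. (y l \<bullet> (M *v y k)) * y l $ i)"
        by (subst inv[OF that]) simp
      finally show ?thesis using t[of i]
        by (simp add: sum_divide_distrib[symmetric] eq_divide_eq mult.commute less_imp_neq[symmetric])
    qed
    \<comment> \<open>The trace of \<open>S D\<^sup>2 P\<close> with \<open>D = diag t\<close>: as \<open>S D\<^sup>2\<close> maps \<open>Y\<close> into itself, it does not depend on \<open>P\<close>.\<close>
    have "(\<Sum>j\<in>UNIV. \<Sum>i\<in>UNIV. S i j * (t j)\<^sup>2 * P (axis i 1) $ j) =
        (\<Sum>i\<in>UNIV. \<Sum>j\<in>UNIV. \<Sum>k\<in>K. g k i * (S i j * t j * y k $ j))"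
      using t by (subst sum.swap, intro sum.cong refl)
        (simp add: Pe sum_distrib_left power2_eq_square less_imp_neq[symmetric] mult_ac)
    also have "\<dots> = (\<Sum>i\<in>UNIV. \<Sum>k\<in>K. g k i * (\<Sum>j\<in>UNIV. S i j * t j * y k $ j))"
      unfolding sum_distrib_left by (intro sum.cong refl sum.swap)
    also have "\<dots> = (\<Sum>i\<in>UNIV. \<Sum>k\<in>K. \<Sum>l\<in>K. (y l \<bullet> (M *v y k)) * (g k i * (y l $ i / t i)))"
      by (intro sum.cong refl) (simp only: Mx sum_distrib_left mult.left_commute)
    also have "\<dots> = (\<Sum>k\<in>K. \<Sum>l\<in>K. (y l \<bullet> (M *v y k)) * (\<Sum>i\<in>UNIV. g k i * (y l $ i / t i)))"
      unfolding sum_distrib_left by (rule sum_rotate)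
    also have "\<dots> = (\<Sum>k\<in>K. y k \<bullet> (M *v y k))"
    proof (intro sum.cong refl)
      fix k assume k: "k \<in> K"
      have "(\<Sum>l\<in>K. (y l \<bullet> (M *v y k)) * (\<Sum>i\<in>UNIV. g k i * (y l $ i / t i))) =
          (\<Sum>l\<in>K. if k = l then y l \<bullet> (M *v y k) else 0)"
        using k by (intro sum.cong refl) (simp only: g_b mult_1_right mult_zero_right split: if_split, simp)
      then show "(\<Sum>l\<in>K. (y l \<bullet> (M *v y k)) * (\<Sum>i\<in>UNIV. g k i * (y l $ i / t i))) = y k \<bullet> (M *v y k)"
        using k by simp
    qed
    finally have trace: "(\<Sum>k\<in>K. y k \<bullet> (M *v y k)) =
        (\<Sum>j\<in>UNIV. \<Sum>i\<in>UNIV. S i j * (t j)\<^sup>2 * P (axis i 1) $ j)" by simp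
    also have "\<dots> \<le> (\<Sum>j\<in>UNIV. (t j)\<^sup>2 * (\<Sum>i\<in>UNIV. \<bar>P (axis i 1) $ j\<bar>))"
      unfolding sum_distrib_left
    proof (intro sum_mono)
      fix j i
      have "S i j * P (axis i 1) $ j \<le> \<bar>S i j\<bar> * \<bar>P (axis i 1) $ j\<bar>" by (metis abs_ge_self abs_mult)
      also have "\<dots> \<le> 1 * \<bar>P (axis i 1) $ j\<bar>" by (intro mult_right_mono S) simp
      finally show "S i j * (t j)\<^sup>2 * P (axis i 1) $ j \<le> (t j)\<^sup>2 * \<bar>P (axis i 1) $ j\<bar>"
        using mult_left_mono[of _ _ "(t j)\<^sup>2"] by (fastforce simp: mult_ac)
    qed
    finally have "(\<Sum>k\<in>K. x k \<bullet> (M *v x k)) \<le> (\<Sum>j\<in>UNIV. (t j)\<^sup>2 * (\<Sum>i\<in>UNIV. \<bar>P (axis i 1) $ j\<bar>))"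
      using max[OF orth] by linarith
    then have "ereal (\<Sum>k\<in>K. x k \<bullet> (M *v x k)) \<le>
        (\<Sum>j\<in>UNIV. ereal ((t j)\<^sup>2) * ereal (\<Sum>i\<in>UNIV. \<bar>P (axis i 1) $ j\<bar>))" by simp
    also have "\<dots> \<le> (\<Sum>j\<in>UNIV. ereal ((t j)\<^sup>2) * operator_norm UNIV infnorm P)"
      by (intro sum_mono ereal_mult_left_mono row_sum_le_operator_norm lin) simp
    also have "\<dots> = ereal (\<Sum>j\<in>UNIV. (t j)\<^sup>2) * operator_norm UNIV infnorm P"
      by (subst sum_ereal[symmetric], subst sum_ereal_left_distrib[symmetric]) auto
    finally show "ereal (\<Sum>i\<in>UNIV. \<Sum>j\<in>UNIV. t i * t j * \<bar>\<Sum>k\<in>K. x k $ i * x k $ j\<bar>)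
        \<le> ereal (\<Sum>i\<in>UNIV. (t i)\<^sup>2) * operator_norm UNIV infnorm P"
      unfolding start .
  qed
qed

lemma max_rel_proj_const_ge:
  fixes x :: "'n::finite \<Rightarrow> real ^ 'n" and t :: "'n \<Rightarrow> real"
  assumes orth: "orthonormal_on K x" and t: "\<And>i. 0 < t i"
    and L: "max_rel_proj_const TYPE('n) (card K) \<le> ereal L"
  shows "(\<Sum>i\<in>UNIV. \<Sum>j\<in>UNIV. t i * t j * \<bar>\<Sum>k\<in>K. x k $ i * x k $ j\<bar>) \<le> L * (\<Sum>i\<in>UNIV. (t i)\<^sup>2)"
    (is "?I \<le> L * ?T")
proof -
  obtain Y :: "(real ^ 'n) set" where Y: "subspace Y" "dim Y = card K"
    "\<And>P. projection_onto UNIV Y P \<Longrightarrow> ereal ?I \<le> ereal ?T * operator_norm UNIV infnorm P"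
    using projection_bound_of_orthonormal[of K x t, OF orth t] by blast
  have T: "0 < ?T" by (intro sum_pos zero_less_power t) auto
  have "ereal (?I / ?T) \<le> operator_norm UNIV infnorm P" if "projection_onto UNIV Y P" for P
    using Y(3)[OF that] T
    by (cases "operator_norm UNIV infnorm P") (auto simp: pos_divide_le_eq mult.commute)
  then have "ereal (?I / ?T) \<le> rel_proj_const Y UNIV infnorm"
    unfolding rel_proj_const_def by (intro INF_greatest) simp
  also have "\<dots> \<le> max_rel_proj_const TYPE('n) (card K)"
    unfolding max_rel_proj_const_def using Y by (intro Sup_upper) auto
  also note L
  finally show ?thesis using T by (simp add: pos_divide_le_eq)
qed

text \<open>The subspace was constructed by dividing by \<open>t\<close>, so weights that may vanish
  are treated as limits of \<open>t i + e\<close> for positive \<open>e\<close> tending to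
  zero.\<close>

lemma max_rel_proj_const_ge_nonneg:
  fixes x :: "'n::finite \<Rightarrow> real ^ 'n" and t :: "'n \<Rightarrow> real"
  assumes orth: "orthonormal_on K x" and t: "\<And>i. 0 \<le> t i"
    and L: "max_rel_proj_const TYPE('n) (card K) \<le> ereal L"
  shows "(\<Sum>i\<in>UNIV. \<Sum>j\<in>UNIV. t i * t j * \<bar>\<Sum>k\<in>K. x k $ i * x k $ j\<bar>) \<le> L * (\<Sum>i\<in>UNIV. (t i)\<^sup>2)"
proof -
  let ?I = "\<lambda>e. \<Sum>i\<in>UNIV. \<Sum>j\<in>UNIV. (t i + e) * (t j + e) * \<bar>\<Sum>k\<in>K. x k $ i * x k $ j\<bar>"
  let ?R = "\<lambda>e. L * (\<Sum>i\<in>UNIV. (t i + e)\<^sup>2)"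
  have "(?I \<longlongrightarrow> ?I 0) (at_right 0)" "(?R \<longlongrightarrow> ?R 0) (at_right 0)"
    by (intro tendsto_intros)+
  moreover have "\<forall>\<^sub>F e in at_right 0. ?I e \<le> ?R e"
    using eventually_at_right_less[of "0::real"]
    by eventually_elim (intro max_rel_proj_const_ge orth L add_nonneg_pos t)
  ultimately have "?I 0 \<le> ?R 0" by (intro tendsto_le[of "at_right 0" ?R "?R 0" ?I "?I 0"]) auto
  then show ?thesis by simp
qed

text \<open>Makes room in \<open>'n\<close> for \<open>r\<close> coordinates, and thus for an
  \<open>r\<close>-dimensional subspace, once there is room for the reduced support.\<close>

lemma le_two_power_times_choose: "r \<le> 2 ^ r * ((r + 1) choose 2)"
proof (cases "r = 0")
  case False
  then have "2 \<le> r + 1" by simp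
  then have "1 \<le> (r + 1) choose 2" by (metis One_nat_def Suc_leI zero_less_binomial)
  then have "r * 1 \<le> 2 ^ r * ((r + 1) choose 2)"
    by (intro mult_mono[OF less_imp_le[OF less_exp]]) auto
  then show ?thesis by simp
qed simp

text \<open>The reduced support injects into \<open>'n\<close>. Scaling \<open>v i\<close> by
  \<open>sqrt (m' i)\<close> turns isotropy into orthonormality of the coordinate vectors
  \<open>x k\<close>, and the same square roots, taken as weights \<open>t\<close>, reproduce energy
  and mass.\<close>

lemma energy_le_max_rel_proj_const:
  fixes v :: "'j \<Rightarrow> 'k \<Rightarrow> real"
  assumes fin: "finite J" "finite K" "K \<noteq> {}" and m: "\<And>i. i \<in> J \<Longrightarrow> 0 \<le> m i"
    and iso: "isotropic J K m v"
    and n: "2 ^ card K * ((card K + 1) choose 2) \<le> CARD('n::finite)"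
    and L: "max_rel_proj_const TYPE('n) (card K) \<le> ereal L"
  shows "energy J K m v \<le> L * sum m J"
proof -
  obtain m' where m': "\<forall>i\<in>J. 0 \<le> m' i" "isotropic J K m' v" "sum m' J = sum m J"
    "energy J K m v \<le> energy J K m' v"
    "card {i\<in>J. m' i \<noteq> 0} \<le> 2 ^ card K * ((card K + 1) choose 2)"
    using reduce_support[OF fin m iso] by blast
  define S where "S = {i\<in>J. m' i \<noteq> 0}"
  have S: "finite S" "S \<subseteq> J" using fin by (auto simp: S_def)
  have to_S: "(\<Sum>i\<in>J. m' i * F i) = (\<Sum>i\<in>S. m' i * F i)" for F
    using S fin by (intro sum.mono_neutral_right) (auto simp: S_def)
  obtain f :: "'j \<Rightarrow> 'n" where f: "inj_on f S"
    using card_le_inj[OF S(1) finite] order_trans[OF m'(5) n] unfolding S_def by blast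
  have "card K \<le> CARD('n)" using le_two_power_times_choose n by (rule order_trans)
  then obtain K' :: "'n set" where K': "card K' = card K"
    using obtain_subset_with_card_n[of "card K" "UNIV :: 'n set"] by blast
  then obtain h where h: "bij_betw h K' K"
    using finite_same_card_bij[OF finite fin(2)] by blast
  define g where "g = inv_into S f"
  have g: "g (f i) = i" if "i \<in> S" for i using that f by (simp add: g_def)
  \<comment> \<open>Indices of \<open>'n\<close> outside the image of the support get weight zero,
    so the values of \<open>g\<close> there do not matter.\<close>
  define t where "t i = (if i \<in> f ` S then sqrt (m' (g i)) else 0)" for i
  define x :: "'n \<Rightarrow> real ^ 'n" where "x k = (\<chi> i. t i * v (g i) (h k))" for k
  have t0: "0 \<le> t i" for i using m'(1) S by (auto simp: t_def g)
  have tsq: "(t (f i))\<^sup>2 = m' i" if "i \<in> S" for i using that m'(1) S by (auto simp: t_def g)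
  have pull: "(\<Sum>i\<in>UNIV. (t i)\<^sup>2 * F (g i)) = (\<Sum>i\<in>S. m' i * F i)" for F
  proof -
    have "(\<Sum>i\<in>UNIV. (t i)\<^sup>2 * F (g i)) = (\<Sum>i\<in>f ` S. (t i)\<^sup>2 * F (g i))"
      by (intro sum.mono_neutral_right) (auto simp: t_def)
    then show ?thesis by (simp add: sum.reindex[OF f] tsq g)
  qed
  have "orthonormal_on K' x"
    unfolding orthonormal_on_def
  proof (intro ballI)
    fix k l assume kl: "k \<in> K'" "l \<in> K'"
    have "x k \<bullet> x l = (\<Sum>i\<in>UNIV. (t i)\<^sup>2 * (v (g i) (h k) * v (g i) (h l)))"
      by (simp add: inner_vec_def x_def power2_eq_square mult_ac)
    also have "\<dots> = (\<Sum>i\<in>J. m' i * (v i (h k) * v i (h l)))"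
      by (simp only: pull[of "\<lambda>i. v i (h k) * v i (h l)"] to_S)
    also have "\<dots> = (if h k = h l then 1 else 0)"
      using m'(2) kl h unfolding isotropic_def by (auto dest: bij_betwE)
    also have "h k = h l \<longleftrightarrow> k = l" using kl h by (auto simp: bij_betw_def inj_on_def)
    finally show "x k \<bullet> x l = (if k = l then 1 else 0)" .
  qed
  then have le: "(\<Sum>i\<in>UNIV. \<Sum>j\<in>UNIV. t i * t j * \<bar>\<Sum>k\<in>K'. x k $ i * x k $ j\<bar>) \<le> L * (\<Sum>i\<in>UNIV. (t i)\<^sup>2)"
    using t0 L K' by (intro max_rel_proj_const_ge_nonneg) simp_all
  have "t i * t j * \<bar>\<Sum>k\<in>K'. x k $ i * x k $ j\<bar> = (t i)\<^sup>2 * ((t j)\<^sup>2 * \<bar>\<Sum>k\<in>K. v (g i) k * v (g j) k\<bar>)" for i j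
  proof -
    have "(\<Sum>k\<in>K'. x k $ i * x k $ j) = t i * t j * (\<Sum>k\<in>K'. v (g i) (h k) * v (g j) (h k))"
      by (simp add: x_def sum_distrib_left mult_ac)
    also have "(\<Sum>k\<in>K'. v (g i) (h k) * v (g j) (h k)) = (\<Sum>k\<in>K. v (g i) k * v (g j) k)"
      by (rule sum.reindex_bij_betw[OF h])
    finally show ?thesis using t0 by (simp add: abs_mult power2_eq_square)
  qed
  then have "(\<Sum>i\<in>UNIV. \<Sum>j\<in>UNIV. t i * t j * \<bar>\<Sum>k\<in>K'. x k $ i * x k $ j\<bar>) =
      (\<Sum>i\<in>UNIV. (t i)\<^sup>2 * (\<Sum>j\<in>UNIV. (t j)\<^sup>2 * \<bar>\<Sum>k\<in>K. v (g i) k * v (g j) k\<bar>))"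
    by (simp only: sum_distrib_left)
  also have "\<dots> = energy J K m' v"
  proof -
    have "(\<Sum>j\<in>UNIV. (t j)\<^sup>2 * \<bar>\<Sum>k\<in>K. v a k * v (g j) k\<bar>) = (\<Sum>j\<in>J. m' j * \<bar>\<Sum>k\<in>K. v a k * v j k\<bar>)" for a
      unfolding to_S by (rule pull)
    moreover have "(\<Sum>i\<in>UNIV. (t i)\<^sup>2 * (\<Sum>j\<in>J. m' j * \<bar>\<Sum>k\<in>K. v (g i) k * v j k\<bar>)) =
        (\<Sum>i\<in>J. m' i * (\<Sum>j\<in>J. m' j * \<bar>\<Sum>k\<in>K. v i k * v j k\<bar>))"
      unfolding to_S[of "\<lambda>i. \<Sum>j\<in>J. m' j * \<bar>\<Sum>k\<in>K. v i k * v j k\<bar>"] by (rule pull)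
    ultimately show ?thesis by (simp add: energy_def sum_distrib_left mult.assoc)
  qed
  finally have "energy J K m' v \<le> L * (\<Sum>i\<in>UNIV. (t i)\<^sup>2)" using le by simp
  also have "(\<Sum>i\<in>UNIV. (t i)\<^sup>2) = sum m J"
    using pull[of "\<lambda>_. 1"] to_S[of "\<lambda>_. 1"] m'(3) by simp
  finally show ?thesis using m'(4) by simp
qed

subsection \<open>A minimax theorem for finitely many convex functions\<close>

text \<open>Ky Fan's weakening of convexity: one point of \<open>C\<close> lies below the mixture
  for all functions at once, so \<open>C\<close> needs no linear structure.\<close>

definition convexlike :: "'c set \<Rightarrow> 'i set \<Rightarrow> ('i \<Rightarrow> 'c \<Rightarrow> real) \<Rightarrow> bool" where
  "convexlike C I F \<longleftrightarrow> (\<forall>x\<in>C. \<forall>y\<in>C. \<forall>s. 0 \<le> s \<longrightarrow> s \<le> 1 \<longrightarrow>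
     (\<exists>z\<in>C. \<forall>i\<in>I. F i z \<le> (1 - s) * F i x + s * F i y))"

text \<open>Put \<open>\<rho> = s / (1 - s)\<close>. Points with \<open>f x < 0\<close> bound
  \<open>\<rho>\<close> from below and points with \<open>g x < 0\<close> bound it from above. If a
  lower bound exceeded an upper one, some mixture of the two points would make both functions
  negative.\<close>

lemma convexlike_pair_nonneg_combination:
  assumes mix: "\<And>x y s. x \<in> C \<Longrightarrow> y \<in> C \<Longrightarrow> 0 \<le> s \<Longrightarrow> s \<le> 1 \<Longrightarrow>
      \<exists>z\<in>C. f z \<le> (1 - s) * f x + s * f y \<and> g z \<le> (1 - s) * g x + s * (g y :: real)"
    and nonneg: "\<And>x. x \<in> C \<Longrightarrow> 0 \<le> f x \<or> 0 \<le> (g x :: real)"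
  obtains s where "0 \<le> s" "s \<le> 1" "\<And>x. x \<in> C \<Longrightarrow> 0 \<le> (1 - s) * f x + s * g x"
proof -
  define A where "A = {x\<in>C. f x < 0}"
  define B where "B = {x\<in>C. g x < 0}"
  consider "A = {}" | "B = {}" | y0 where "A \<noteq> {}" "y0 \<in> B" by blast
  then show ?thesis
  proof cases
    case 1
    then show ?thesis by (intro that[of 0]) (auto simp: A_def not_less)
  next
    case 2
    then show ?thesis by (intro that[of 1]) (auto simp: B_def not_less)
  next
    case 3
    \<comment> \<open>The lower bound from \<open>x\<close> is at most the upper bound from
      \<open>y\<close>; cross-multiplied, since \<open>g x\<close> is not yet known to be
      nonzero.\<close>
    have cross: "f x * g y \<le> f y * g x" if "x \<in> A" "y \<in> B" for x y
    proof (rule ccontr)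
      assume less: "\<not> f x * g y \<le> f y * g x"
      have x: "x \<in> C" "f x < 0" "0 \<le> g x" using that nonneg[of x] by (auto simp: A_def)
      have y: "y \<in> C" "g y < 0" "0 \<le> f y" using that nonneg[of y] by (auto simp: B_def)
      \<comment> \<open>\<open>\<delta>\<close> is a slack: \<open>\<rho>\<close> below is chosen so
        that \<open>g x + \<rho> * g y = - \<delta>\<close>, and the \<open>+ 1\<close> both keeps
        the denominator positive and leaves \<open>f x + \<rho> * f y\<close> strictly
        negative.\<close>
      define \<delta> where "\<delta> = (f x * g y - f y * g x) / (f y + 1)"
      have \<delta>: "0 < \<delta>" "\<delta> * (f y + 1) = f x * g y - f y * g x" using less y by (simp_all add: \<delta>_def)
      define \<rho> where "\<rho> = (g x + \<delta>) / - g y"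
      have \<rho>: "0 < \<rho>" "\<rho> * g y = - (g x + \<delta>)" using \<delta>(1) x y by (simp_all add: \<rho>_def divide_pos_neg)
      have "(g x + \<delta>) * f y < f x * g y" using \<delta> by (simp add: algebra_simps)
      moreover have "(\<rho> * f y + f x) * - g y = f y * - (\<rho> * g y) - f x * g y"
        by (simp add: algebra_simps)
      ultimately have "(\<rho> * f y + f x) * - g y < 0"
        unfolding \<rho>(2) by (simp add: mult.commute add.commute)
      then have fneg: "f x + \<rho> * f y < 0" using y(2) by (simp add: mult_less_0_iff zero_less_mult_iff add.commute)
      have gneg: "g x + \<rho> * g y < 0" using \<rho> \<delta> by simp
      define s where "s = \<rho> / (1 + \<rho>)"
      have s: "0 \<le> s" "s \<le> 1" "1 - s = 1 / (1 + \<rho>)" using \<rho>(1) by (auto simp: s_def field_simps)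
      obtain z where z: "z \<in> C" "f z \<le> (1 - s) * f x + s * f y" "g z \<le> (1 - s) * g x + s * g y"
        using mix[OF x(1) y(1) s(1,2)] by blast
      have "(1 - s) * f x + s * f y = (f x + \<rho> * f y) / (1 + \<rho>)"
        "(1 - s) * g x + s * g y = (g x + \<rho> * g y) / (1 + \<rho>)"
        unfolding s(3) by (simp_all add: s_def add_divide_distrib)
      moreover have "(f x + \<rho> * f y) / (1 + \<rho>) < 0" "(g x + \<rho> * g y) / (1 + \<rho>) < 0"
        using fneg gneg \<rho>(1) by (auto intro!: divide_neg_pos)
      ultimately show False using z nonneg[OF z(1)] by linarith
    qed
    have gpos: "0 < g x" if "x \<in> A" for x
    proof -
      have "0 < f x * g y0" using that 3(2) by (simp add: A_def B_def mult_neg_neg)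
      with cross[OF that 3(2)] have "0 < f y0 * g x" by simp
      moreover have "0 \<le> g x" using that nonneg[of x] by (auto simp: A_def)
      ultimately show ?thesis by (cases "g x = 0") auto
    qed
    have ratio: "- f x / g x \<le> f y / - g y" if "x \<in> A" "y \<in> B" for x y
      using cross[OF that] gpos[OF that(1)] that(2) by (simp add: B_def field_simps)
    \<comment> \<open>The least admissible ratio; the point \<open>y0\<close> bounds the
      supremum.\<close>
    define \<rho> where "\<rho> = (SUP x\<in>A. - f x / g x)"
    have bdd: "bdd_above ((\<lambda>x. - f x / g x) ` A)" 
      by (rule bdd_aboveI2[of _ _ "f y0 / - g y0"]) (rule ratio[OF _ 3(2)])
    have upper: "- f x / g x \<le> \<rho>" if "x \<in> A" for x
      unfolding \<rho>_def using bdd that by (rule cSUP_upper2) simp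
    have lower: "\<rho> \<le> f y / - g y" if "y \<in> B" for y
      unfolding \<rho>_def using 3(1) ratio[OF _ that] by (rule cSUP_least)
    obtain x0 where "x0 \<in> A" using 3(1) by blast
    have "0 \<le> - f x0 / g x0" using \<open>x0 \<in> A\<close> gpos[of x0] by (intro divide_nonneg_pos) (auto simp: A_def)
    then have \<rho>0: "0 \<le> \<rho>" using upper[OF \<open>x0 \<in> A\<close>] by linarith
    have comb: "0 \<le> f x + \<rho> * g x" if "x \<in> C" for x
    proof (cases "x \<in> A")
      case True
      then show ?thesis using upper[OF True] gpos[OF True] by (simp add: field_simps)
    next
      case False
      show ?thesis
      proof (cases "x \<in> B")
        case True
        then show ?thesis using lower[OF True] by (simp add: B_def field_simps)
      next
        case False
        with \<open>x \<notin> A\<close> that show ?thesis using \<rho>0 by (simp add: A_def B_def)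
      qed
    qed
    show ?thesis
    proof (rule that[of "\<rho> / (1 + \<rho>)"])
      have eq: "1 - \<rho> / (1 + \<rho>) = 1 / (1 + \<rho>)" using \<rho>0 by (simp add: field_simps)
      show "0 \<le> (1 - \<rho> / (1 + \<rho>)) * f x + \<rho> / (1 + \<rho>) * g x" if "x \<in> C" for x
      proof -
        have "(1 - \<rho> / (1 + \<rho>)) * f x + \<rho> / (1 + \<rho>) * g x = (f x + \<rho> * g x) / (1 + \<rho>)"
          unfolding eq by (simp add: add_divide_distrib)
        then show ?thesis using comb[OF that] \<rho>0 by simp
      qed
    qed (use \<rho>0 in auto)
  qed
qed

text \<open>Induction on the number of functions. On the points where \<open>F i\<close> is
  negative, the induction hypothesis gives a nonnegative combination \<open>g\<close> of the others;
  the two-function case then combines \<open>g\<close> with \<open>F i\<close> on all of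
  \<open>C\<close>.\<close>

lemma convexlike_nonneg_combination:
  fixes F :: "'i \<Rightarrow> 'c \<Rightarrow> real"
  assumes "finite I" "I \<noteq> {}" "convexlike C I F" "\<And>x. x \<in> C \<Longrightarrow> \<exists>i\<in>I. 0 \<le> F i x"
  shows "\<exists>a. (\<forall>i\<in>I. 0 \<le> a i) \<and> sum a I = 1 \<and> (\<forall>x\<in>C. 0 \<le> (\<Sum>i\<in>I. a i * F i x))"
  using assms
proof (induction I arbitrary: C rule: finite_ne_induct)
  case (singleton i)
  then show ?case by (intro exI[of _ "\<lambda>_. 1"]) auto
next
  case (insert i I)
  let ?C = "{x\<in>C. F i x < 0}"
  have "convexlike ?C I F"
    unfolding convexlike_def
  proof (intro ballI allI impI)
    fix x y and s :: real
    assume x: "x \<in> ?C" and y: "y \<in> ?C" and s: "0 \<le> s" "s \<le> 1"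
    then obtain z where z: "z \<in> C" "\<forall>j\<in>insert i I. F j z \<le> (1 - s) * F j x + s * F j y"
      using insert.prems(1) unfolding convexlike_def by (metis (no_types, lifting) mem_Collect_eq)
    have "(1 - s) * F i x + s * F i y < 0"
    proof (cases "s = 1")
      case False
      then have "(1 - s) * F i x < 0" using x s by (simp add: mult_pos_neg)
      moreover have "s * F i y \<le> 0" using y s by (simp add: mult_nonneg_nonpos)
      ultimately show ?thesis by simp
    qed (use y in simp)
    moreover have "F i z \<le> (1 - s) * F i x + s * F i y" using z(2) by simp
    ultimately have "z \<in> ?C" using z(1) by simp
    with z(2) show "\<exists>z\<in>?C. \<forall>j\<in>I. F j z \<le> (1 - s) * F j x + s * F j y" by blast
  qed
  moreover have "\<exists>j\<in>I. 0 \<le> F j x" if "x \<in> ?C" for x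
    using insert.prems(2)[of x] that by auto
  ultimately obtain a where a: "\<forall>j\<in>I. 0 \<le> a j" "sum a I = 1" "\<forall>x\<in>?C. 0 \<le> (\<Sum>j\<in>I. a j * F j x)"
    using insert.IH[of ?C] by blast
  define g where "g x = (\<Sum>j\<in>I. a j * F j x)" for x
  obtain s where s: "0 \<le> s" "s \<le> 1" "\<And>x. x \<in> C \<Longrightarrow> 0 \<le> (1 - s) * g x + s * F i x"
  proof (rule convexlike_pair_nonneg_combination[of C g "F i"])
    fix x y and s :: real
    assume xy: "x \<in> C" "y \<in> C" and s: "0 \<le> s" "s \<le> 1"
    then obtain z where z: "z \<in> C" "\<forall>j\<in>insert i I. F j z \<le> (1 - s) * F j x + s * F j y"
      using insert.prems(1) unfolding convexlike_def by blast
    have "g z \<le> (\<Sum>j\<in>I. a j * ((1 - s) * F j x + s * F j y))"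
      unfolding g_def using a(1) z(2) by (intro sum_mono mult_left_mono) auto
    also have "\<dots> = (1 - s) * g x + s * g y"
      by (simp add: g_def distrib_left sum.distrib sum_distrib_left mult.left_commute)
    finally show "\<exists>z\<in>C. g z \<le> (1 - s) * g x + s * g y \<and> F i z \<le> (1 - s) * F i x + s * F i y"
      using z by blast
  next
    show "0 \<le> g x \<or> 0 \<le> F i x" if "x \<in> C" for x
      using a(3) that by (cases "F i x < 0") (auto simp: g_def)
  qed blast
  define a' where "a' j = (if j = i then s else (1 - s) * a j)" for j
  have split: "(\<Sum>j\<in>insert i I. a' j * G j) = (1 - s) * (\<Sum>j\<in>I. a j * G j) + s * G i" for G
  proof -
    have "(\<Sum>j\<in>I. a' j * G j) = (1 - s) * (\<Sum>j\<in>I. a j * G j)"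
      unfolding sum_distrib_left using insert.hyps by (intro sum.cong) (auto simp: a'_def)
    then show ?thesis using insert.hyps by (simp add: a'_def)
  qed
  show ?case
  proof (intro exI[of _ a'] conjI ballI)
    show "0 \<le> a' j" if "j \<in> insert i I" for j using that a(1) s by (auto simp: a'_def)
    show "sum a' (insert i I) = 1" using split[of "\<lambda>_. 1"] a(2) by simp
    show "0 \<le> (\<Sum>j\<in>insert i I. a' j * F j x)" if "x \<in> C" for x
      unfolding split using s(3)[OF that] by (simp add: g_def)
  qed
qed

section \<open>Orthonormal bases for a form that is positive on a subspace\<close>

lemma gram_schmidt:
  fixes g :: "'v::real_vector \<Rightarrow> 'v \<Rightarrow> real" and e :: "'k \<Rightarrow> 'v"
  assumes lin: "\<And>z. linear (g z)" and sym: "\<And>z w. g z w = g w z"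
    and "finite K" "inj_on e K" "independent (e ` K)"
    and "\<And>z. z \<in> span (e ` K) \<Longrightarrow> z \<noteq> 0 \<Longrightarrow> 0 < g z z"
  shows "\<exists>b. span (b ` K) = span (e ` K) \<and> (\<forall>k\<in>K. \<forall>l\<in>K. g (b k) (b l) = (if k = l then 1 else 0))"
  using assms(3-)
proof (induction K rule: finite_induct)
  case empty
  then show ?case by simp
next
  case (insert k K)
  have notin: "e k \<notin> e ` K" using insert by (auto simp: inj_on_def)
  have indep: "independent (e ` K)" "e k \<notin> span (e ` K)"
    using insert.prems(2) notin by (simp_all add: independent_insert)
  have sub: "span (e ` K) \<subseteq> span (e ` insert k K)" by (intro span_mono) auto
  obtain b where b: "span (b ` K) = span (e ` K)" "\<forall>k\<in>K. \<forall>l\<in>K. g (b k) (b l) = (if k = l then 1 else 0)"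
    using insert.IH insert.prems(1,3) indep(1) sub by (auto simp: inj_on_insert)
  define u where "u = (\<Sum>l\<in>K. g (b l) (e k) *\<^sub>R b l)"
  define w where "w = e k - u"
  have u: "u \<in> span (e ` K)"
    unfolding u_def b(1)[symmetric] by (intro span_sum span_scale span_base) auto
  have "w \<noteq> 0" using u indep(2) by (auto simp: w_def)
  have w_span: "w \<in> span (e ` insert k K)"
    unfolding w_def using u sub by (intro span_diff) (auto intro: span_base)
  \<comment> \<open>The form is only assumed positive on the span, so \<open>w\<close> is placed
    there before it is normalised.\<close>
  then have pos: "0 < g w w" using insert.prems(3) \<open>w \<noteq> 0\<close> by blast
  have orth: "g (b l) w = 0" if "l \<in> K" for l
  proof -
    have "g (b l) u = (\<Sum>l'\<in>K. g (b l') (e k) * g (b l) (b l'))"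
      unfolding u_def by (simp add: linear_sum[OF lin] linear_cmul[OF lin])
    also have "\<dots> = (\<Sum>l'\<in>K. if l = l' then g (b l') (e k) else 0)"
      using b(2) that by (intro sum.cong) auto
    finally show ?thesis using that insert.hyps by (simp add: w_def linear_diff[OF lin])
  qed
  define c where "c = 1 / sqrt (g w w)"
  have c: "c \<noteq> 0" "c * c * g w w = 1" using pos by (auto simp: c_def)
  define b' where "b' = b(k := c *\<^sub>R w)"
  have img: "b' ` insert k K = insert (c *\<^sub>R w) (b ` K)"
    using insert.hyps by (auto simp: b'_def)
  have scale: "g (c *\<^sub>R w) z = c * g w z" for z by (subst (1 2) sym) (simp add: linear_cmul[OF lin])
  show ?case
  proof (intro exI[of _ b'] conjI ballI)
    show "span (b' ` insert k K) = span (e ` insert k K)"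
    proof (rule antisym; rule span_minimal)
      show "b' ` insert k K \<subseteq> span (e ` insert k K)"
        unfolding img using w_span b(1) sub span_superset[of "b ` K"] by (auto intro: span_scale)
      have "span (b ` K) \<subseteq> span (insert (c *\<^sub>R w) (b ` K))" by (intro span_mono) auto
      then have K_sub: "span (e ` K) \<subseteq> span (b' ` insert k K)" unfolding img b(1) .
      have "(1 / c) *\<^sub>R (c *\<^sub>R w) \<in> span (b' ` insert k K)"
        unfolding img by (intro span_scale span_base) simp
      then have "w \<in> span (b' ` insert k K)" using c by simp
      then have "w + u \<in> span (b' ` insert k K)" using u K_sub by (intro span_add) auto
      then show "e ` insert k K \<subseteq> span (b' ` insert k K)"
        using K_sub span_superset[of "e ` K"] by (auto simp: w_def)
    qed (rule subspace_span)+
    fix l l' assume "l \<in> insert k K" "l' \<in> insert k K"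
    then consider "l = k" "l' = k" | "l = k" "l' \<in> K" | "l \<in> K" "l' = k" | "l \<in> K" "l' \<in> K" by auto
    then show "g (b' l) (b' l') = (if l = l' then 1 else 0)"
    proof cases
      case 1
      then show ?thesis using c by (simp add: b'_def scale linear_cmul[OF lin])
    next
      case 2
      then show ?thesis using insert.hyps orth[of l'] sym by (auto simp: b'_def scale)
    next
      case 3
      then show ?thesis using insert.hyps orth[of l] by (auto simp: b'_def linear_cmul[OF lin])
    next
      case 4
      then show ?thesis using insert.hyps b(2) by (auto simp: b'_def)
    qed
  qed
qed

subsection \<open>Norming functionals\<close>

definition sublinear :: "('v::real_vector \<Rightarrow> real) \<Rightarrow> bool" where
  "sublinear p \<longleftrightarrow> (\<forall>x y. p (x + y) \<le> p x + p y) \<and> (\<forall>c x. 0 \<le> c \<longrightarrow> p (c *\<^sub>R x) = c * p x)"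

lemma sublinear_zero: "sublinear p \<Longrightarrow> p 0 = 0"
  unfolding sublinear_def by (metis mult_zero_left order_refl scaleR_zero_left)

lemma sublinear_minus: "sublinear p \<Longrightarrow> - p (- x) \<le> p x"
proof -
  assume p: "sublinear p"
  have "p (x + - x) \<le> p x + p (- x)" using p unfolding sublinear_def by blast
  then show ?thesis using sublinear_zero[OF p] by simp
qed

text \<open>The core of the Hahn-Banach argument: \<open>q\<close> lies below \<open>p\<close>
  (\<open>t = 0\<close>) and \<open>q (- z) \<le> - p z\<close> (\<open>t = 1\<close>), so a linear
  functional below \<open>q\<close> attains \<open>p z\<close> at \<open>z\<close>. Taking the
  infimum over all \<open>t\<close> keeps \<open>q\<close> sublinear.\<close>

lemma sublinear_shift:
  fixes p :: "'v::real_vector \<Rightarrow> real" and z :: 'v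
  assumes p: "sublinear p"
  obtains q where "sublinear q" "\<And>x t. 0 \<le> t \<Longrightarrow> q x \<le> p (x + t *\<^sub>R z) - t * p z"
proof -
  define q where "q x = (INF t\<in>{0..}. p (x + t *\<^sub>R z) - t * p z)" for x
  have add: "p (x + y) \<le> p x + p y" and hom: "0 \<le> c \<Longrightarrow> p (c *\<^sub>R x) = c * p x" for x y c
    using p by (auto simp: sublinear_def)
  have lb: "- p (- x) \<le> p (x + t *\<^sub>R z) - t * p z" if "0 \<le> t" for x t
    using add[of "x + t *\<^sub>R z" "- x"] hom[OF that, of z] by simp
  have bdd: "bdd_below ((\<lambda>t. p (x + t *\<^sub>R z) - t * p z) ` {0..})" for x
    using lb by (intro bdd_belowI2[of _ "- p (- x)"]) auto
  have upper: "q x \<le> p (x + t *\<^sub>R z) - t * p z" if "0 \<le> t" for x t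
    unfolding q_def using that by (intro cINF_lower bdd) auto
  have greatest: "a \<le> q x" if "\<And>t. 0 \<le> t \<Longrightarrow> a \<le> p (x + t *\<^sub>R z) - t * p z" for a x
    unfolding q_def using that by (intro cINF_greatest) auto
  have q_add: "q (x + y) \<le> q x + q y" for x y
  proof -
    have "q (x + y) - (p (x + t *\<^sub>R z) - t * p z) \<le> p (y + s *\<^sub>R z) - s * p z" if "0 \<le> t" "0 \<le> s" for t s
    proof -
      have "q (x + y) \<le> p ((x + t *\<^sub>R z) + (y + s *\<^sub>R z)) - (t + s) * p z"
        using upper[of "t + s" "x + y"] that by (simp add: scaleR_add_left algebra_simps)
      then show ?thesis using add[of "x + t *\<^sub>R z" "y + s *\<^sub>R z"] by (simp add: algebra_simps)
    qed
    then have "q (x + y) - (p (x + t *\<^sub>R z) - t * p z) \<le> q y" if "0 \<le> t" for t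
      using that by (intro greatest)
    then have "q (x + y) - q y \<le> q x"
      by (intro greatest) (simp add: algebra_simps)
    then show ?thesis by simp
  qed
  have q_hom_le: "q (c *\<^sub>R x) \<le> c * q x" if c: "0 < c" for c x
  proof -
    have "q (c *\<^sub>R x) / c \<le> q x"
    proof (rule greatest)
      fix t :: real assume t: "0 \<le> t"
      have "q (c *\<^sub>R x) \<le> p (c *\<^sub>R (x + t *\<^sub>R z)) - (c * t) * p z"
        using upper[of "c * t" "c *\<^sub>R x"] c t by (simp add: scaleR_add_right)
      then have "q (c *\<^sub>R x) \<le> c * (p (x + t *\<^sub>R z) - t * p z)"
        using hom[of c "x + t *\<^sub>R z"] c by (simp add: algebra_simps)
      then show "q (c *\<^sub>R x) / c \<le> p (x + t *\<^sub>R z) - t * p z"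
        using c by (simp add: pos_divide_le_eq mult.commute)
    qed
    then show ?thesis using c by (simp add: pos_divide_le_eq mult.commute)
  qed
  have q0: "q 0 = 0"
  proof (rule antisym)
    have "p 0 = 0" by (rule sublinear_zero[OF p])
    then show "q 0 \<le> 0" using upper[of 0 0] by simp
    show "0 \<le> q 0" by (intro greatest) (simp add: hom)
  qed
  have "q (c *\<^sub>R x) = c * q x" if "0 \<le> c" for c x
  proof (cases "c = 0")
    case False
    then have c: "0 < c" using that by simp
    have "q ((1 / c) *\<^sub>R (c *\<^sub>R x)) \<le> (1 / c) * q (c *\<^sub>R x)" using c by (intro q_hom_le) simp
    then have "c * q x \<le> q (c *\<^sub>R x)" using c by (simp add: field_simps)
    with q_hom_le[OF c] show ?thesis by (intro antisym)
  qed (simp add: q0)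
  with q_add have "sublinear q" by (simp add: sublinear_def)
  then show ?thesis using upper by (rule that)
qed

text \<open>The shift of \<open>p\<close> by \<open>y\<close> is sublinear and below
  \<open>p\<close>, hence equal to \<open>p\<close>; its bound at \<open>t = 1\<close> gives
  superadditivity.\<close>

lemma minimal_sublinear_is_linear:
  assumes p: "sublinear p" and min: "\<And>q. sublinear q \<Longrightarrow> (\<And>x. q x \<le> p x) \<Longrightarrow> q = p"
  shows "linear p"
proof -
  have add: "p (x + y) = p x + p y" for x y
  proof (rule antisym)
    obtain q where q: "sublinear q" "\<And>x t. 0 \<le> t \<Longrightarrow> q x \<le> p (x + t *\<^sub>R y) - t * p y"
      using sublinear_shift[OF p, where z = y] by blast
    have "q = p" using q(2)[of 0] by (intro min q(1)) simp
    then show "p x + p y \<le> p (x + y)" using q(2)[of 1 x] by simp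
  qed (use p in \<open>simp add: sublinear_def\<close>)
  have hom: "p (c *\<^sub>R x) = c * p x" if "0 \<le> c" for c x using p that by (simp add: sublinear_def)
  have neg: "p (- x) = - p x" for x using add[of x "- x"] sublinear_zero[OF p] by simp
  show ?thesis
  proof (rule linearI)
    show "p (c *\<^sub>R x) = c *\<^sub>R p x" for c x
      using hom[of c x] hom[of "- c" x] neg[of "c *\<^sub>R x"] by (cases "0 \<le> c") auto
  qed (rule add)
qed

text \<open>Zorn's lemma for the reversed order gives a minimal sublinear functional below
  \<open>p\<close>. Nonempty chains are bounded by their pointwise infima.\<close>

lemma exists_linear_below_sublinear:
  fixes p :: "'v::real_vector \<Rightarrow> real"
  assumes p: "sublinear p"
  shows "\<exists>f. linear f \<and> (\<forall>x. f x \<le> p x)"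
proof -
  define A where "A = {q. sublinear q \<and> (\<forall>x. q x \<le> p x)}"
  have "\<exists>m\<in>A. \<forall>q\<in>A. m \<ge> q \<longrightarrow> q = m"
  proof (rule predicate_Zorn)
    show "partial_order_on A (relation_of (\<ge>) A)"
      by (rule partial_order_on_relation_ofI) auto
    fix C assume C: "C \<in> Chains (relation_of (\<ge>) A)"
    show "\<exists>u\<in>A. \<forall>q\<in>C. q \<ge> u"
    proof (cases "C = {}")
      case True
      with p show ?thesis by (auto simp: A_def)
    next
      case False
      have sub: "q \<in> A" if "q \<in> C" for q using C that by (auto simp: Chains_def relation_of_def)
      have total: "q \<le> q' \<or> q' \<le> q" if "q \<in> C" "q' \<in> C" for q q'
        using C that by (auto simp: Chains_def relation_of_def)
      define u where "u x = (INF q\<in>C. q x)" for x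
      have lb: "- p (- x) \<le> q x" if "q \<in> C" for q x
      proof -
        have "- q (- x) \<le> q x" "q (- x) \<le> p (- x)"
          using sub[OF that] sublinear_minus by (auto simp: A_def)
        then show ?thesis by linarith
      qed
      have u_le: "u x \<le> q x" if "q \<in> C" for q x
        unfolding u_def using that lb by (intro cINF_lower bdd_belowI2[of _ "- p (- x)"]) auto
      have greatest: "a \<le> u x" if "\<And>q. q \<in> C \<Longrightarrow> a \<le> q x" for a x
        unfolding u_def using that False by (intro cINF_greatest) auto
      have "u (x + y) \<le> u x + u y" for x y
      proof -
        have "u (x + y) - q x \<le> q' y" if qC: "q \<in> C" "q' \<in> C" for q q'
        proof -
          \<comment> \<open>Subadditivity of the infimum needs one functional below both
            \<open>q\<close> and \<open>q'\<close>, which the chain provides.\<close>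
          obtain r where r: "r \<in> C" "r \<le> q" "r \<le> q'" using total[OF qC] qC by blast
          have "u (x + y) \<le> r (x + y)" by (rule u_le[OF r(1)])
          also have "\<dots> \<le> r x + r y" using sub[OF r(1)] by (simp add: A_def sublinear_def)
          also have "\<dots> \<le> q x + q' y" using r by (intro add_mono) (auto simp: le_fun_def)
          finally show ?thesis by simp
        qed
        then have "u (x + y) - q x \<le> u y" if "q \<in> C" for q using that by (intro greatest)
        then have "u (x + y) - u y \<le> u x" by (intro greatest) (simp add: algebra_simps)
        then show ?thesis by simp
      qed
      moreover have "u (c *\<^sub>R x) = c * u x" if "0 \<le> c" for c x
      proof -
        have hom: "q (c *\<^sub>R x) = c * q x" if "q \<in> C" for q
          using sub[OF that] \<open>0 \<le> c\<close> by (simp add: A_def sublinear_def)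
        have "u (c *\<^sub>R x) = (INF q\<in>C. c * q x)" by (simp add: u_def hom cong: INF_cong)
        also have "\<dots> = c * u x"
        proof (cases "c = 0")
          case True
          then show ?thesis using False by simp
        next
          case c: False
          then have c: "0 < c" using that by simp
          show ?thesis
          proof (rule antisym)
            have "(INF q\<in>C. c * q x) / c \<le> u x"
            proof (rule greatest)
              fix q assume q: "q \<in> C"
              have "(INF q\<in>C. c * q x) \<le> c * q x"
                using lb[of _ x] c q
                by (intro cINF_lower bdd_belowI2[of _ "c * - p (- x)"] mult_left_mono) auto
              then show "(INF q\<in>C. c * q x) / c \<le> q x" using c by (simp add: pos_divide_le_eq mult.commute)
            qed
            then show "(INF q\<in>C. c * q x) \<le> c * u x" using c by (simp add: pos_divide_le_eq mult.commute)
            show "c * u x \<le> (INF q\<in>C. c * q x)"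
              using False c u_le by (intro cINF_greatest mult_left_mono) auto
          qed
        qed
        finally show ?thesis .
      qed
      ultimately have "sublinear u" by (simp add: sublinear_def)
      moreover obtain q where "q \<in> C" using False by blast
      then have "u x \<le> p x" for x using u_le[of q x] sub[of q] by (auto simp: A_def intro: order_trans)
      ultimately show ?thesis using u_le by (intro bexI[of _ u]) (auto simp: A_def le_fun_def)
    qed
  qed
  then obtain m where m: "m \<in> A" "\<And>q. q \<in> A \<Longrightarrow> q \<le> m \<Longrightarrow> q = m" by blast
  have "linear m"
  proof (rule minimal_sublinear_is_linear)
    fix q assume q: "sublinear q" "\<And>x. q x \<le> m x"
    have "q x \<le> p x" for x using q(2)[of x] m(1) by (auto simp: A_def intro: order_trans)
    then show "q = m" using q by (intro m(2)) (auto simp: A_def le_fun_def)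
  qed (use m in \<open>simp add: A_def\<close>)
  then show ?thesis using m(1) by (auto simp: A_def)
qed

lemma norming_functional:
  fixes X :: "'v::real_vector set"
  assumes X: "normed_space_on X N" and z: "z \<in> X"
  obtains f :: "'v \<Rightarrow> real" where "linear f" "f z = N z" "\<And>x. x \<in> X \<Longrightarrow> \<bar>f x\<bar> \<le> N x"
proof -
  have sX: "subspace X" using X by (simp add: normed_space_on_def)
  obtain \<pi> :: "'v \<Rightarrow> 'v" where \<pi>: "range \<pi> \<subseteq> X" "linear \<pi>" "\<And>x. x \<in> X \<Longrightarrow> \<pi> x = x"
    using linear_exists_left_inverse_on[OF linear_id sX] by auto
  \<comment> \<open>\<open>N\<close> is arbitrary outside \<open>X\<close>; composing it with a
    linear retraction onto \<open>X\<close> makes it sublinear on the whole type.\<close>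
  define p where "p x = N (\<pi> x)" for x
  have \<pi>X: "\<pi> x \<in> X" for x using \<pi>(1) by auto
  have p: "sublinear p"
    using X \<pi>X unfolding sublinear_def p_def normed_space_on_def
    by (simp add: linear_add[OF \<pi>(2)] linear_cmul[OF \<pi>(2)])
  obtain q where q: "sublinear q" "\<And>x t. 0 \<le> t \<Longrightarrow> q x \<le> p (x + t *\<^sub>R z) - t * p z"
    using sublinear_shift[OF p, where z = z] by blast
  obtain f where f: "linear f" "\<And>x. f x \<le> q x" using exists_linear_below_sublinear[OF q(1)] by blast
  have fp: "f x \<le> p x" for x using f(2)[of x] q(2)[of 0 x] by simp
  have pX: "p x = N x" if "x \<in> X" for x using \<pi>(3)[OF that] by (simp add: p_def)
  show ?thesis
  proof (rule that[OF f(1)])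
    have "f (- z) \<le> - p z" using f(2)[of "- z"] q(2)[of 1 "- z"] sublinear_zero[OF p] by simp
    then show "f z = N z" using fp[of z] pX[OF z] by (simp add: linear_neg[OF f(1)])
    show "\<bar>f x\<bar> \<le> N x" if "x \<in> X" for x
    proof -
      have "N (- x) = N x" using X that unfolding normed_space_on_def
        by (metis abs_minus_cancel abs_one mult_1 scaleR_minus1_left)
      then show ?thesis
        using fp[of x] fp[of "- x"] pX[OF that] pX[of "- x"] subspace_neg[OF sX that]
        by (simp add: linear_neg[OF f(1)] abs_le_iff)
    qed
  qed
qed

subsection \<open>Upper bounds for relative projection constants\<close>

text \<open>If no such \<open>q\<close> existed, the minimax theorem would give weights
  \<open>a\<close> whose average of the row sums is at least \<open>L + \<epsilon>\<close> for every
  projection. For slightly perturbed weights, the orthogonal projection of the weighted form has an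
  energy as its average, and \<open>bound\<close> controls that.\<close>

lemma small_projection_on_finite_family:
  fixes \<phi> :: "'i \<Rightarrow> 'v::real_vector \<Rightarrow> real" and e :: "'k \<Rightarrow> 'v"
  assumes lin: "\<And>i. i \<in> I \<Longrightarrow> linear (\<phi> i)"
    and fin: "finite I" "finite K" "K \<noteq> {}"
    and e: "inj_on e K" "independent (e ` K)"
    and sep: "\<And>z. z \<in> span (e ` K) \<Longrightarrow> z \<noteq> 0 \<Longrightarrow> \<exists>i\<in>I. \<phi> i z \<noteq> 0"
    and bound: "\<And>a (v :: 'i \<Rightarrow> 'k \<Rightarrow> real). (\<And>i. i \<in> I \<Longrightarrow> 0 \<le> a i) \<Longrightarrow> isotropic I K a v \<Longrightarrow>
      energy I K a v \<le> L * sum a I"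
    and \<epsilon>: "0 < \<epsilon>"
  shows "\<exists>q. (\<forall>i\<in>I. q i \<in> span (e ` K)) \<and> (\<forall>z\<in>span (e ` K). (\<Sum>i\<in>I. \<phi> i z *\<^sub>R q i) = z) \<and>
    (\<forall>j\<in>I. (\<Sum>i\<in>I. \<bar>\<phi> j (q i)\<bar>) \<le> L + \<epsilon>)"
proof (rule ccontr)
  assume contra: "\<not> ?thesis"
  let ?Z = "span (e ` K)"
  \<comment> \<open>A member \<open>q\<close> of \<open>C\<close> encodes the projection onto
    \<open>?Z\<close> that sends \<open>z\<close> to
    \<open>\<Sum>i\<in>I. \<phi> i z *\<^sub>R q i\<close>; \<open>F j\<close> is its absolute row
    sum at \<open>j\<close> minus the target.\<close>
  define C where "C = {q. (\<forall>i\<in>I. q i \<in> ?Z) \<and> (\<forall>z\<in>?Z. (\<Sum>i\<in>I. \<phi> i z *\<^sub>R q i) = z)}"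
  define F where "F j q = (\<Sum>i\<in>I. \<bar>\<phi> j (q i)\<bar>) - (L + \<epsilon>)" for j and q :: "'i \<Rightarrow> 'v"
  have "I \<noteq> {}"
  proof
    assume "I = {}"
    obtain k where k: "k \<in> K" using fin(3) by blast
    then have "e k \<noteq> 0" using e(2) dependent_zero[of "e ` K"] by (metis imageI)
    then show False using sep[of "e k"] k \<open>I = {}\<close> by (simp add: span_base)
  qed
  have "convexlike C I F"
    unfolding convexlike_def
  proof (intro ballI allI impI)
    fix x y and s :: real
    assume x: "x \<in> C" and y: "y \<in> C" and s: "0 \<le> s" "s \<le> 1"
    define z where "z i = (1 - s) *\<^sub>R x i + s *\<^sub>R y i" for i
    have "(\<Sum>i\<in>I. \<phi> i w *\<^sub>R z i) = w" if "w \<in> ?Z" for w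
    proof -
      have "(\<Sum>i\<in>I. \<phi> i w *\<^sub>R z i) = (\<Sum>i\<in>I. (1 - s) *\<^sub>R (\<phi> i w *\<^sub>R x i) + s *\<^sub>R (\<phi> i w *\<^sub>R y i))"
        by (intro sum.cong refl) (simp add: z_def scaleR_add_right mult.commute)
      also have "\<dots> = (1 - s) *\<^sub>R w + s *\<^sub>R w"
        unfolding sum.distrib scaleR_sum_right[symmetric] using x y that by (simp add: C_def)
      finally show ?thesis by (simp add: scaleR_add_left[symmetric])
    qed
    moreover have "z i \<in> ?Z" if "i \<in> I" for i
      unfolding z_def using x y that by (intro span_add span_scale) (auto simp: C_def)
    ultimately have "z \<in> C" by (simp add: C_def)
    moreover have "F j z \<le> (1 - s) * F j x + s * F j y" if "j \<in> I" for j
    proof -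
      have "(\<Sum>i\<in>I. \<bar>\<phi> j (z i)\<bar>) \<le> (\<Sum>i\<in>I. (1 - s) * \<bar>\<phi> j (x i)\<bar> + s * \<bar>\<phi> j (y i)\<bar>)"
      proof (rule sum_mono)
        fix i
        have "\<phi> j (z i) = (1 - s) * \<phi> j (x i) + s * \<phi> j (y i)"
          unfolding z_def by (simp add: linear_add[OF lin[OF that]] linear_cmul[OF lin[OF that]])
        also have "\<bar>\<dots>\<bar> \<le> \<bar>(1 - s) * \<phi> j (x i)\<bar> + \<bar>s * \<phi> j (y i)\<bar>" by (rule abs_triangle_ineq)
        finally show "\<bar>\<phi> j (z i)\<bar> \<le> (1 - s) * \<bar>\<phi> j (x i)\<bar> + s * \<bar>\<phi> j (y i)\<bar>"
          using s by (simp add: abs_mult)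
      qed
      also have "\<dots> = (1 - s) * (\<Sum>i\<in>I. \<bar>\<phi> j (x i)\<bar>) + s * (\<Sum>i\<in>I. \<bar>\<phi> j (y i)\<bar>)"
        by (simp only: sum.distrib sum_distrib_left)
      finally show ?thesis by (simp add: F_def algebra_simps)
    qed
    ultimately show "\<exists>z\<in>C. \<forall>j\<in>I. F j z \<le> (1 - s) * F j x + s * F j y" by blast
  qed
  moreover have "\<exists>j\<in>I. 0 \<le> F j q" if "q \<in> C" for q
  proof (rule ccontr)
    assume "\<not> (\<exists>j\<in>I. 0 \<le> F j q)"
    then have "\<forall>j\<in>I. (\<Sum>i\<in>I. \<bar>\<phi> j (q i)\<bar>) \<le> L + \<epsilon>" by (auto simp: F_def)
    with contra that show False by (auto simp: C_def)
  qed
  ultimately obtain a where a: "\<forall>i\<in>I. 0 \<le> a i" "sum a I = 1" "\<forall>q\<in>C. 0 \<le> (\<Sum>j\<in>I. a j * F j q)"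
    using convexlike_nonneg_combination[OF fin(1) \<open>I \<noteq> {}\<close>] by blast
  \<comment> \<open>The weights are perturbed to be positive, so that the weighted form \<open>g\<close> below is definite.\<close>
  define \<eta> where "\<eta> = \<epsilon> / ((\<bar>L\<bar> + 1) * real (card I))"
  have cI: "0 < real (card I)" using \<open>I \<noteq> {}\<close> fin(1) by (simp add: card_gt_0_iff)
  have \<eta>: "0 < \<eta>" unfolding \<eta>_def using \<epsilon> cI by (intro divide_pos_pos mult_pos_pos) auto
  \<comment> \<open>The mass added by \<open>\<eta>\<close> costs less than
    \<open>\<epsilon>\<close>; the \<open>+ 1\<close> in its denominator guards against
    \<open>L = 0\<close>.\<close>
  have "L * (\<eta> * real (card I)) = L * \<epsilon> / (\<bar>L\<bar> + 1)" using cI by (simp add: \<eta>_def)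
  also have "\<dots> < \<epsilon>"
  proof -
    have "L * \<epsilon> < \<epsilon> * (\<bar>L\<bar> + 1)" using \<epsilon> by (simp add: mult.commute[of L])
    then show ?thesis by (simp add: pos_divide_less_eq)
  qed
  finally have L\<eta>: "L * (\<eta> * real (card I)) < \<epsilon>" .
  define a' where "a' i = a i + \<eta>" for i
  have a'_pos: "0 < a' i" if "i \<in> I" for i using a(1) \<eta> that by (simp add: a'_def add_nonneg_pos)
  have sum_a': "sum a' I = 1 + \<eta> * real (card I)" using a(2) by (simp add: a'_def sum.distrib mult.commute)
  define g where "g z w = (\<Sum>i\<in>I. a' i * \<phi> i z * \<phi> i w)" for z w
  have g_lin: "linear (g z)" for z
    unfolding g_def
    by (intro linearI)
      (simp_all add: linear_add[OF lin] linear_cmul[OF lin] distrib_left sum.distrib sum_distrib_left mult_ac)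
  have g_sym: "g z w = g w z" for z w by (simp add: g_def mult_ac)
  have "0 < g z z" if z: "z \<in> ?Z" "z \<noteq> 0" for z
  proof -
    obtain i where i: "i \<in> I" "\<phi> i z \<noteq> 0" using sep[OF z] by blast
    have "0 < a' i * \<phi> i z * \<phi> i z" using a'_pos[OF i(1)] i(2) by (simp add: mult.assoc flip: power2_eq_square)
    moreover have "0 \<le> a' j * \<phi> j z * \<phi> j z" if "j \<in> I" for j
      using a'_pos[OF that] by (simp add: mult.assoc less_imp_le)
    ultimately show ?thesis unfolding g_def using i(1) fin(1) by (intro sum_pos2[of I i])
  qed
  then obtain b where b: "span (b ` K) = ?Z" "\<forall>k\<in>K. \<forall>l\<in>K. g (b k) (b l) = (if k = l then 1 else 0)"
    using gram_schmidt[of g K e, OF g_lin g_sym fin(2) e] by blast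
  define v where "v i k = \<phi> i (b k)" for i k
  \<comment> \<open>This \<open>q\<close> encodes the \<open>g\<close>-orthogonal projection, which
    sends \<open>z\<close> to \<open>\<Sum>k\<in>K. g (b k) z *\<^sub>R b k\<close>.\<close>
  define q where "q i = a' i *\<^sub>R (\<Sum>k\<in>K. v i k *\<^sub>R b k)" for i
  have "isotropic I K a' v"
    using b(2) by (simp add: isotropic_def g_def v_def mult.assoc)
  then have energy: "energy I K a' v \<le> L * sum a' I"
    using a'_pos by (intro bound) (auto intro: less_imp_le)
  have "q \<in> C"
    unfolding C_def
  proof (intro CollectI conjI ballI)
    show "q i \<in> ?Z" for i
      unfolding q_def b(1)[symmetric] by (intro span_scale span_sum span_base) auto
    fix z assume z: "z \<in> ?Z"
    have "(\<Sum>i\<in>I. \<phi> i z *\<^sub>R q i) = (\<Sum>k\<in>K. \<Sum>i\<in>I. (a' i * \<phi> i (b k) * \<phi> i z) *\<^sub>R b k)"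
      unfolding q_def scaleR_sum_right
      by (subst sum.swap) (simp add: v_def mult_ac)
    also have "\<dots> = (\<Sum>k\<in>K. g (b k) z *\<^sub>R b k)" by (simp add: g_def scaleR_sum_left)
    also have "\<dots> = z"
      using b z by (intro biorthogonal_expansion[symmetric] g_lin fin(2)) auto
    finally show "(\<Sum>i\<in>I. \<phi> i z *\<^sub>R q i) = z" .
  qed
  have \<phi>_q: "\<phi> j (q i) = a' i * (\<Sum>k\<in>K. v j k * v i k)" if "j \<in> I" for i j
    unfolding q_def
    by (simp add: linear_sum[OF lin[OF that]] linear_cmul[OF lin[OF that]] v_def mult.commute)
  have "(\<Sum>j\<in>I. a' j * (\<Sum>i\<in>I. \<bar>\<phi> j (q i)\<bar>)) = energy I K a' v"
    unfolding energy_def sum_distrib_left[of "a' _"]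
  proof (intro sum.cong refl)
    fix j i assume "j \<in> I" "i \<in> I"
    then show "a' j * \<bar>\<phi> j (q i)\<bar> = a' j * a' i * \<bar>\<Sum>k\<in>K. v j k * v i k\<bar>"
      by (simp only: \<phi>_q abs_mult abs_of_pos[OF a'_pos] mult.assoc)
  qed
  moreover have "(\<Sum>j\<in>I. a j * (\<Sum>i\<in>I. \<bar>\<phi> j (q i)\<bar>)) \<le> (\<Sum>j\<in>I. a' j * (\<Sum>i\<in>I. \<bar>\<phi> j (q i)\<bar>))"
    using \<eta> by (intro sum_mono mult_right_mono sum_nonneg) (auto simp: a'_def)
  moreover have "(\<Sum>j\<in>I. a j * F j q) = (\<Sum>j\<in>I. a j * (\<Sum>i\<in>I. \<bar>\<phi> j (q i)\<bar>)) - (L + \<epsilon>)"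
    unfolding F_def right_diff_distrib sum_subtractf by (simp add: sum_distrib_right[symmetric] a(2))
  moreover have "0 \<le> (\<Sum>j\<in>I. a j * F j q)" using a(3) \<open>q \<in> C\<close> by blast
  ultimately have "L + \<epsilon> \<le> L * sum a' I" using energy by linarith
  then show False using L\<eta> by (simp add: sum_a' distrib_left)
qed

text \<open>Compactness is found in coordinates: \<open>N\<close> composed with the synthesis map
  \<open>T\<close> is Lipschitz and, on coefficients supported in \<open>K\<close>, at least a
  positive multiple of the Euclidean norm. The coefficients of the unit sphere thus form a compact
  set, and \<open>T\<close> maps a net of it to a net.\<close>

lemma finite_net_unit_sphere:
  fixes e :: "'k::finite \<Rightarrow> 'v::real_vector" and K :: "'k set"
  assumes X: "normed_space_on X N" and eX: "e ` K \<subseteq> X"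
    and e: "inj_on e K" "independent (e ` K)" and \<epsilon>: "0 < \<epsilon>"
  obtains F where "finite F" "F \<subseteq> {z \<in> span (e ` K). N z = 1}"
    "\<And>z. z \<in> span (e ` K) \<Longrightarrow> N z = 1 \<Longrightarrow> \<exists>w\<in>F. N (z - w) < \<epsilon>"
proof -
  have sX: "subspace X" and N0: "\<And>x. x \<in> X \<Longrightarrow> 0 \<le> N x" and Nz: "\<And>x. x \<in> X \<Longrightarrow> N x = 0 \<longleftrightarrow> x = 0"
    and Nh: "\<And>c x. x \<in> X \<Longrightarrow> N (c *\<^sub>R x) = \<bar>c\<bar> * N x"
    and Nt: "\<And>x y. x \<in> X \<Longrightarrow> y \<in> X \<Longrightarrow> N (x + y) \<le> N x + N y"
    using X by (auto simp: normed_space_on_def)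
  define T where "T c = (\<Sum>k\<in>K. (c $ k) *\<^sub>R e k)" for c :: "real ^ 'k"
  have T_lin: "linear T"
    by (intro linearI) (simp_all add: T_def scaleR_add_left sum.distrib scaleR_sum_right)
  have TX: "T c \<in> X" for c
    unfolding T_def using eX by (intro subspace_sum subspace_scale sX) auto
  define M where "M = (\<Sum>k\<in>K. N (e k))"
  have M0: "0 \<le> M" unfolding M_def using eX N0 by (intro sum_nonneg) auto
  have N_sum: "N (\<Sum>k\<in>A. f k) \<le> (\<Sum>k\<in>A. N (f k))" if "finite A" "\<And>k. k \<in> A \<Longrightarrow> f k \<in> X" for A and f :: "'k \<Rightarrow> 'v"
    using that
  proof (induction A rule: finite_induct)
    case empty
    then show ?case using Nz[of 0] subspace_0[OF sX] by simp
  next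
    case (insert k A)
    then have "N (f k + sum f A) \<le> N (f k) + N (sum f A)" by (intro Nt subspace_sum[OF sX]) auto
    then show ?case using insert by force
  qed
  have NT: "N (T c) \<le> norm c * M" for c
  proof -
    have "N (T c) \<le> (\<Sum>k\<in>K. N ((c $ k) *\<^sub>R e k))"
      unfolding T_def using eX by (intro N_sum subspace_scale[OF sX]) auto
    also have "\<dots> \<le> (\<Sum>k\<in>K. norm c * N (e k))"
    proof (rule sum_mono)
      fix k assume "k \<in> K"
      then have ek: "e k \<in> X" using eX by blast
      show "N ((c $ k) *\<^sub>R e k) \<le> norm c * N (e k)"
        unfolding Nh[OF ek] by (intro mult_right_mono N0 ek component_le_norm_cart)
    qed
    finally show ?thesis by (simp add: M_def sum_distrib_left)
  qed
  have Ndiff: "\<bar>N (T c) - N (T d)\<bar> \<le> M * dist c d" for c d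
  proof -
    have *: "N (T c) - N (T d) \<le> M * dist c d" for c d
    proof -
      have "N (T d + T (c - d)) \<le> N (T d) + N (T (c - d))" by (intro Nt TX)
      moreover have "T d + T (c - d) = T c" by (simp add: linear_diff[OF T_lin])
      ultimately show ?thesis using NT[of "c - d"] by (simp add: dist_norm mult.commute)
    qed
    show ?thesis using *[of c d] *[of d c] by (simp add: abs_le_iff dist_commute)
  qed
  have cont: "continuous_on A (\<lambda>c. N (T c))" for A
  proof (rule lipschitz_on_continuous_on)
    show "M-lipschitz_on A (\<lambda>c. N (T c))"
      using Ndiff M0 by (intro lipschitz_onI) (auto simp: dist_real_def)
  qed
  \<comment> \<open>\<open>T\<close> ignores coordinates outside \<open>K\<close>; setting them to
    zero makes it injective.\<close>
  define W where "W = {c :: real ^ 'k. \<forall>k. k \<notin> K \<longrightarrow> c $ k = 0}"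
  have "closed W"
    unfolding W_def by (intro closed_Collect_all closed_Collect_imp closed_Collect_eq continuous_intros) auto
  have W_scale: "a *\<^sub>R c \<in> W" if "c \<in> W" for a c using that by (simp add: W_def)
  have T_nz: "T c \<noteq> 0" if "c \<in> W" "c \<noteq> 0" for c
  proof
    assume "T c = 0"
    then have "(\<Sum>w\<in>e ` K. (c $ inv_into K e w) *\<^sub>R w) = 0"
      by (simp add: T_def sum.reindex[OF e(1)] inv_into_f_f[OF e(1)])
    then have "c $ inv_into K e w = 0" if "w \<in> e ` K" for w
      using independentD[OF e(2) _ subset_refl _ that] by simp
    then have "c $ k = 0" if "k \<in> K" for k
      using that by (metis imageI inv_into_f_f[OF e(1)])
    then have "c = 0" using \<open>c \<in> W\<close> by (auto simp: W_def vec_eq_iff)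
    with that show False by simp
  qed
  have "\<exists>m>0. \<forall>c\<in>W. m * norm c \<le> N (T c)"
  proof (cases "W \<inter> sphere 0 1 = {}")
    case True
    have "c = 0" if "c \<in> W" for c
    proof (rule ccontr)
      assume "c \<noteq> 0"
      then have "(1 / norm c) *\<^sub>R c \<in> W \<inter> sphere 0 1" using W_scale[OF that] by simp
      with True show False by blast
    qed
    then have "1 * norm c \<le> N (T c)" if "c \<in> W" for c using N0[OF TX, of c] that by fastforce
    then show ?thesis using zero_less_one by blast
  next
    case False
    have "compact (W \<inter> sphere 0 1)" using \<open>closed W\<close> by (simp add: closed_Int_compact)
    then obtain c0 where c0: "c0 \<in> W \<inter> sphere 0 1" "\<forall>c\<in>W \<inter> sphere 0 1. N (T c0) \<le> N (T c)"
      using continuous_attains_inf[OF _ False cont] by blast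
    have "0 < N (T c0)"
      using N0[OF TX, of c0] Nz[OF TX, of c0] T_nz[of c0] c0(1) by fastforce
    moreover have "N (T c0) * norm c \<le> N (T c)" if "c \<in> W" for c
    proof (cases "c = 0")
      case True
      then show ?thesis using N0 TX by simp
    next
      case False
      then have "N (T c0) \<le> N (T ((1 / norm c) *\<^sub>R c))" using W_scale[OF that] c0(2) by simp
      also have "\<dots> = N (T c) / norm c" by (simp add: linear_cmul[OF T_lin] Nh[OF TX])
      finally show ?thesis using False by (simp add: pos_le_divide_eq)
    qed
    ultimately show ?thesis by blast
  qed
  then obtain m where m: "0 < m" "\<And>c. c \<in> W \<Longrightarrow> m * norm c \<le> N (T c)" by blast
  define S where "S = {c \<in> W. N (T c) = 1}"
  have "S = W \<inter> {c. N (T c) = 1}" by (auto simp: S_def)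
  then have "closed S"
    using \<open>closed W\<close> by (auto intro!: closed_Int closed_Collect_eq cont continuous_on_const)
  moreover have "bounded S"
    by (rule boundedI[of _ "1 / m"]) (use m in \<open>force simp: S_def pos_le_divide_eq mult.commute\<close>)
  ultimately have "seq_compact S" by (simp add: compact_eq_bounded_closed flip: compact_eq_seq_compact_metric)
  \<comment> \<open>\<open>T\<close> stretches distances by at most \<open>M\<close>, and
    \<open>M + 1\<close> avoids a zero denominator.\<close>
  have "0 < \<epsilon> / (M + 1)" using \<epsilon> M0 by simp
  with seq_compact_imp_totally_bounded[OF \<open>seq_compact S\<close>]
  obtain G where "finite G \<and> G \<subseteq> S \<and> S \<subseteq> (\<Union>c\<in>G. ball c (\<epsilon> / (M + 1)))" by meson
  then have G: "finite G" "G \<subseteq> S" "S \<subseteq> (\<Union>c\<in>G. ball c (\<epsilon> / (M + 1)))" by auto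
  have T_span: "T c \<in> span (e ` K)" for c
    unfolding T_def by (intro span_sum span_scale span_base) auto
  have T_onto: "\<exists>c\<in>W. T c = z" if z: "z \<in> span (e ` K)" for z
  proof -
    obtain u where u: "z = (\<Sum>w\<in>e ` K. u w *\<^sub>R w)" 
      using z span_finite[OF finite_imageI[OF finite[of K]], of e] by auto
    show ?thesis
      by (rule bexI[of _ "\<chi> k. if k \<in> K then u (e k) else 0"])
        (auto simp: T_def W_def u sum.reindex[OF e(1)] intro!: sum.cong)
  qed
  show ?thesis
  proof (rule that[of "T ` G"])
    show "finite (T ` G)" using G(1) by simp
    show "T ` G \<subseteq> {z \<in> span (e ` K). N z = 1}" using G(2) T_span by (auto simp: S_def)
    show "\<exists>w\<in>T ` G. N (z - w) < \<epsilon>" if z: "z \<in> span (e ` K)" "N z = 1" for z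
    proof -
      obtain c where c: "c \<in> W" "T c = z" using T_onto[OF z(1)] by blast
      then have "c \<in> S" using z by (simp add: S_def)
      then obtain d where d: "d \<in> G" "dist d c < \<epsilon> / (M + 1)" using G(3) by auto
      have "N (T (c - d)) \<le> norm (c - d) * M" by (rule NT)
      also have "\<dots> \<le> dist d c * (M + 1)"
        using M0 by (intro mult_mono) (auto simp: dist_norm norm_minus_commute)
      also have "\<dots> < \<epsilon>" using d(2) M0 by (simp add: pos_less_divide_eq)
      finally show ?thesis using d(1) c(2) by (auto simp: linear_diff[OF T_lin])
    qed
  qed
qed

text \<open>Norming functionals at an \<open>\<epsilon>\<close>-net of the unit sphere of the
  subspace recover \<open>N\<close> there up to the factor \<open>1 - \<epsilon>\<close>. A
  projection with row sums at most \<open>L + \<epsilon>\<close> on this family thus has norm at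
  most \<open>(L + \<epsilon>) / (1 - \<epsilon>)\<close>, and \<open>\<epsilon>\<close> tends to
  zero.\<close>

lemma rel_proj_const_le:
  fixes X :: "'v::real_vector set" and e :: "'n::finite \<Rightarrow> 'v"
  assumes X: "normed_space_on X N" and K: "K \<noteq> {}" and eX: "e ` K \<subseteq> X"
    and e: "inj_on e K" "independent (e ` K)"
    and bound: "\<And>I a (v :: 'v \<Rightarrow> 'n \<Rightarrow> real). finite I \<Longrightarrow> (\<And>i. i \<in> I \<Longrightarrow> 0 \<le> a i) \<Longrightarrow>
      isotropic I K a v \<Longrightarrow> energy I K a v \<le> L * sum a I"
  shows "rel_proj_const (span (e ` K)) X N \<le> ereal L"
proof -
  let ?Z = "span (e ` K)"
  have sX: "subspace X" and N0: "\<And>x. x \<in> X \<Longrightarrow> 0 \<le> N x" and Nz: "\<And>x. x \<in> X \<Longrightarrow> N x = 0 \<longleftrightarrow> x = 0"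
    and Nh: "\<And>c x. x \<in> X \<Longrightarrow> N (c *\<^sub>R x) = \<bar>c\<bar> * N x"
    using X by (auto simp: normed_space_on_def)
  have ZX: "?Z \<subseteq> X" using eX sX by (rule span_minimal)
  have approx: "rel_proj_const ?Z X N \<le> ereal ((L + \<epsilon>) / (1 - \<epsilon>))" if \<epsilon>: "0 < \<epsilon>" "\<epsilon> < 1" for \<epsilon>
  proof -
    obtain F where F: "finite F" "F \<subseteq> {z \<in> ?Z. N z = 1}"
      "\<And>z. z \<in> ?Z \<Longrightarrow> N z = 1 \<Longrightarrow> \<exists>w\<in>F. N (z - w) < \<epsilon>"
      using finite_net_unit_sphere[OF X eX e \<epsilon>(1)] by blast
    have "\<forall>w\<in>F. \<exists>f. linear f \<and> f w = N w \<and> (\<forall>x\<in>X. \<bar>f x\<bar> \<le> N x)"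
    proof
      fix w assume "w \<in> F"
      then have "w \<in> X" using F(2) ZX by auto
      then obtain f :: "'v \<Rightarrow> real" where "linear f" "f w = N w" "\<And>x. x \<in> X \<Longrightarrow> \<bar>f x\<bar> \<le> N x"
        using norming_functional[OF X] by metis
      then show "\<exists>f. linear f \<and> f w = N w \<and> (\<forall>x\<in>X. \<bar>f x\<bar> \<le> N x)" by blast
    qed
    then obtain \<phi> where \<phi>: "\<forall>w\<in>F. linear (\<phi> w) \<and> \<phi> w w = N w \<and> (\<forall>x\<in>X. \<bar>\<phi> w x\<bar> \<le> N x)"
      by (rule bchoice[THEN exE])
    then have lin: "linear (\<phi> w)" and \<phi>_self: "\<phi> w w = N w" and \<phi>_le: "x \<in> X \<Longrightarrow> \<bar>\<phi> w x\<bar> \<le> N x"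
      if "w \<in> F" for w x using that by blast+
    have norming: "\<exists>w\<in>F. (1 - \<epsilon>) * N z \<le> \<bar>\<phi> w z\<bar>" if z: "z \<in> ?Z" "z \<noteq> 0" for z
    proof -
      have "z \<in> X" using z ZX by blast
      then have Npos: "0 < N z" using N0 Nz z(2) by force
      define y where "y = (1 / N z) *\<^sub>R z"
      have y: "y \<in> ?Z" "N y = 1" using z Npos Nh[OF \<open>z \<in> X\<close>] by (auto simp: y_def intro: span_scale)
      obtain w where w: "w \<in> F" "N (y - w) < \<epsilon>" using F(3)[OF y] by blast
      have "w \<in> ?Z" "N w = 1" using w(1) F(2) by auto
      then have "y - w \<in> X" using y(1) ZX by (meson span_diff subsetD)
      from \<phi>_le[OF w(1) this] have "\<phi> w w - \<epsilon> \<le> \<phi> w y"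
        using w(2) by (simp add: linear_diff[OF lin[OF w(1)]])
      then have "1 - \<epsilon> \<le> \<phi> w y" using \<phi>_self[OF w(1)] \<open>N w = 1\<close> by simp
      also have "\<dots> = \<phi> w z / N z" by (simp add: y_def linear_cmul[OF lin[OF w(1)]])
      finally have "(1 - \<epsilon>) * N z \<le> \<phi> w z" using Npos by (simp add: pos_le_divide_eq)
      then show ?thesis using w(1) by (intro bexI[of _ w]) auto
    qed
    have sep: "\<exists>w\<in>F. \<phi> w z \<noteq> 0" if z: "z \<in> ?Z" "z \<noteq> 0" for z
    proof -
      obtain w where w: "w \<in> F" "(1 - \<epsilon>) * N z \<le> \<bar>\<phi> w z\<bar>" using norming[OF z] by blast
      have "z \<in> X" using z ZX by blast
      then have "0 < N z" using N0 Nz z(2) by force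
      then have "0 < (1 - \<epsilon>) * N z" using \<epsilon> by simp
      with w show ?thesis by (intro bexI[of _ w]) auto
    qed
    obtain q where q: "\<forall>w\<in>F. q w \<in> ?Z" "\<forall>z\<in>?Z. (\<Sum>w\<in>F. \<phi> w z *\<^sub>R q w) = z"
      "\<forall>u\<in>F. (\<Sum>w\<in>F. \<bar>\<phi> u (q w)\<bar>) \<le> L + \<epsilon>"
      using small_projection_on_finite_family[of F \<phi> K e L \<epsilon>, OF lin F(1) finite K e sep bound[OF F(1)] \<epsilon>(1)]
      by blast
    define P where "P x = (\<Sum>w\<in>F. \<phi> w x *\<^sub>R q w)" for x
    have PZ: "P x \<in> ?Z" for x unfolding P_def using q(1) by (intro span_sum span_scale) auto
    have Pid: "P z = z" if "z \<in> ?Z" for z using q(2) that by (simp add: P_def)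
    have "projection_onto X ?Z P"
      unfolding projection_onto_def
    proof (intro conjI)
      show "linear_map_on X P"
        unfolding linear_map_on_def P_def
        by (simp add: linear_add[OF lin] linear_cmul[OF lin] scaleR_add_left sum.distrib scaleR_sum_right)
      show "P ` X = ?Z"
      proof (intro antisym subsetI)
        fix z assume z: "z \<in> ?Z"
        then show "z \<in> P ` X" using ZX by (intro image_eqI[of z P z]) (auto simp: Pid)
      qed (use PZ in auto)
      show "\<forall>x\<in>X. P (P x) = P x" using PZ Pid by blast
    qed
    then have "rel_proj_const ?Z X N \<le> operator_norm X N P"
      unfolding rel_proj_const_def by (intro INF_lower) simp
    also have "\<dots> \<le> ereal ((L + \<epsilon>) / (1 - \<epsilon>))"
      unfolding operator_norm_def
    proof (intro SUP_least)
      fix x assume "x \<in> {x \<in> X. N x \<le> 1}"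
      then have x: "x \<in> X" "N x \<le> 1" by auto
      have step: "\<bar>\<phi> u (P x)\<bar> \<le> L + \<epsilon>" if u: "u \<in> F" for u
      proof -
        have "\<bar>\<phi> u (P x)\<bar> = \<bar>\<Sum>w\<in>F. \<phi> w x * \<phi> u (q w)\<bar>"
          by (simp add: P_def linear_sum[OF lin[OF u]] linear_cmul[OF lin[OF u]])
        also have "\<dots> \<le> (\<Sum>w\<in>F. \<bar>\<phi> w x * \<phi> u (q w)\<bar>)" by (rule sum_abs)
        also have "\<dots> \<le> (\<Sum>w\<in>F. 1 * \<bar>\<phi> u (q w)\<bar>)"
          unfolding abs_mult using \<phi>_le[OF _ x(1)] x(2) by (intro sum_mono mult_right_mono) force+
        also have "\<dots> \<le> L + \<epsilon>" using q(3) u by simp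
        finally show ?thesis .
      qed
      \<comment> \<open>If \<open>P x = 0\<close>, some \<open>u\<close> in \<open>F\<close> is
        still needed to conclude \<open>0 \<le> L + \<epsilon>\<close>; a basis vector supplies it
        through \<open>sep\<close>.\<close>
      have "\<exists>u\<in>F. (1 - \<epsilon>) * N (P x) \<le> \<bar>\<phi> u (P x)\<bar>"
      proof (cases "P x = 0")
        case True
        obtain k where k: "k \<in> K" using K by blast
        then have "e k \<noteq> 0" using e(2) dependent_zero[of "e ` K"] by (metis imageI)
        then obtain u where "u \<in> F" using sep[of "e k"] k by (auto simp: span_base)
        moreover have "N (P x) = 0" using True Nz[of 0] subspace_0[OF sX] by simp
        ultimately show ?thesis by auto
      qed (use norming PZ in blast)
      then have "(1 - \<epsilon>) * N (P x) \<le> L + \<epsilon>" using step by force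
      then show "ereal (N (P x)) \<le> ereal ((L + \<epsilon>) / (1 - \<epsilon>))"
        using \<epsilon> by (simp add: pos_le_divide_eq mult.commute)
    qed
    finally show ?thesis .
  qed
  have "((\<lambda>\<epsilon>. ereal ((L + \<epsilon>) / (1 - \<epsilon>))) \<longlongrightarrow> ereal ((L + 0) / (1 - 0))) (at_right 0)"
    by (intro tendsto_intros) auto
  moreover have "\<forall>\<^sub>F \<epsilon> in at_right 0. rel_proj_const ?Z X N \<le> ereal ((L + \<epsilon>) / (1 - \<epsilon>))"
    
    using eventually_at_right_real[OF zero_less_one] by eventually_elim (simp add: approx)
  ultimately have "rel_proj_const ?Z X N \<le> ereal ((L + 0) / (1 - 0))"
    by (intro tendsto_lowerbound) auto
  then show ?thesis by simp
qed

section \<open>Nonnegativity and isometric images\<close>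

lemma operator_norm_nonneg:
  assumes X: "normed_space_on X N" and P: "linear_map_on X P"
  shows "0 \<le> operator_norm X N P"
proof -
  have 0: "0 \<in> X" "N 0 = 0" using X by (auto simp: normed_space_on_def subspace_0)
  have "P (0 *\<^sub>R 0) = 0 *\<^sub>R P 0" using P 0 unfolding linear_map_on_def by blast
  then have "P 0 = 0" by simp
  with 0 show ?thesis unfolding operator_norm_def by (intro SUP_upper2[of 0]) auto
qed

lemma rel_proj_const_nonneg: "normed_space_on X N \<Longrightarrow> 0 \<le> rel_proj_const Y X N"
  unfolding rel_proj_const_def by (intro INF_greatest operator_norm_nonneg) (auto simp: projection_onto_def)

text \<open>Rules out minus infinity, the value of the supremum if there were no subspace of
  dimension \<open>r\<close>.\<close>

lemma max_rel_proj_const_nonneg: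
  assumes "r \<le> CARD('n::finite)"
  shows "0 \<le> max_rel_proj_const TYPE('n) r"
proof -
  obtain Y :: "(real ^ 'n) set" where "subspace Y" "dim Y = r"
    using choose_subspace_of_subspace[of r "UNIV :: (real ^ 'n) set"] assms by auto
  then have "rel_proj_const Y UNIV infnorm \<le> max_rel_proj_const TYPE('n) r"
    unfolding max_rel_proj_const_def by (intro Sup_upper) auto
  then show ?thesis by (rule order_trans[OF rel_proj_const_nonneg[OF normed_space_on_infnorm]])
qed

lemma dim_isometric_image:
  assumes X: "normed_space_on X N" and Y: "normed_space_on Y M" and T: "isometric_embedding Y M X N T"
  shows "subspace (T ` Y)" "T ` Y \<subseteq> X" "dim (T ` Y) = dim Y"
proof -
  have sY: "subspace Y" using Y by (simp add: normed_space_on_def)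
  show "T ` Y \<subseteq> X" using T by (simp add: isometric_embedding_def)
  obtain B where B: "B \<subseteq> Y" "independent B" "Y \<subseteq> span B" "card B = dim Y" by (rule basis_exists)
  have YB: "Y = span B" using B sY by (simp add: span_subspace)
  \<comment> \<open>\<open>T\<close> is controlled only on \<open>Y\<close>, while the dimension
    lemmas want a map linear everywhere. \<open>T'\<close> extends its values on a basis and agrees
    with it on \<open>Y\<close>.\<close>
  obtain T' where T': "linear T'" "\<forall>x\<in>B. T' x = T x" using linear_independent_extend[OF B(2)] by blast
  have add: "T (x + y) = T x + T y" if "x \<in> Y" "y \<in> Y" for x y
    using T that by (auto simp: isometric_embedding_def linear_map_on_def)
  have scale: "T (c *\<^sub>R x) = c *\<^sub>R T x" if "x \<in> Y" for c x
    using T that by (auto simp: isometric_embedding_def linear_map_on_def)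
  have "T (0 *\<^sub>R 0) = 0 *\<^sub>R T 0" using subspace_0[OF sY] by (intro scale)
  then have "subspace {x \<in> Y. T' x = T x}"
    using sY by (intro subspaceI)
      (simp_all add: add scale subspace_0 subspace_add subspace_scale linear_0[OF T'(1)]
        linear_add[OF T'(1)] linear_cmul[OF T'(1)])
  then have "span B \<subseteq> {x \<in> Y. T' x = T x}" using B(1) T'(2) by (intro span_minimal) auto
  then have eq: "T' x = T x" if "x \<in> Y" for x using that YB by blast
  have img: "T ` Y = T' ` Y" using eq by (intro image_cong) auto
  show "subspace (T ` Y)" unfolding img by (intro linear_subspace_image T' sY)
  have "inj_on T' Y"
  proof (subst linear_inj_on_iff_eq_0[OF T'(1) sY], intro ballI impI)
    fix x assume x: "x \<in> Y" "T' x = 0"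
    have "N (T x) = M x" using T x(1) by (simp add: isometric_embedding_def)
    moreover have "N 0 = 0" using X by (auto simp: normed_space_on_def subspace_0)
    ultimately have "M x = 0" using eq x by simp
    then show "x = 0" using Y x(1) by (simp add: normed_space_on_def)
  qed
  then have "independent (T' ` B)" "inj_on T' B"
    using B YB linear_independent_injective_image[OF T'(1) B(2)] by (auto intro: inj_on_subset)
  moreover have "T' ` Y = span (T' ` B)" unfolding YB by (rule linear_span_image[OF T'(1), symmetric])
  ultimately show "dim (T ` Y) = dim Y"
    unfolding img using B(4) by (simp add: dim_span dim_eq_card_independent card_image)
qed

subsection \<open>Transfer to the universe\<close>

text \<open>A projection in the copy is conjugated back by \<open>f\<close>; its norm does not grow
  because \<open>f\<close> maps the unit ball isometrically into that of the copy.\<close>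

lemma rel_proj_const_image_ge:
  fixes f :: "'a::real_vector \<Rightarrow> 'b::real_vector"
  assumes f: "linear f" "inj f" and emb: "isometric_embedding UNIV N (range f) M f"
  shows "rel_proj_const Y UNIV N \<le> rel_proj_const (f ` Y) (range f) M"
  unfolding rel_proj_const_def
proof (intro INF_greatest)
  fix P assume "P \<in> {P. projection_onto (range f) (f ` Y) P}"
  then have P: "linear_map_on (range f) P" "P ` range f = f ` Y" "\<And>x. x \<in> range f \<Longrightarrow> P (P x) = P x"
    by (auto simp: projection_onto_def)
  define Q where "Q x = inv f (P (f x))" for x
  have fQ: "f (Q x) = P (f x)" for x
    unfolding Q_def using P(2) by (intro f_inv_into_f) blast
  have N: "M (f x) = N x" for x using emb by (simp add: isometric_embedding_def)
  have "projection_onto UNIV Y Q"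
    unfolding projection_onto_def linear_map_on_def
  proof (intro conjI ballI allI)
    show "Q (x + y) = Q x + Q y" for x y
      using P(1) by (intro injD[OF f(2)]) (simp add: linear_add[OF f(1)] fQ linear_map_on_def)
    show "Q (c *\<^sub>R x) = c *\<^sub>R Q x" for c x
      using P(1) by (intro injD[OF f(2)]) (simp add: linear_cmul[OF f(1)] fQ linear_map_on_def)
    show "Q (Q x) = Q x" for x
      using P(3) by (intro injD[OF f(2)]) (simp add: fQ)
    have "f ` range Q = f ` Y" using P(2) by (simp add: image_image fQ)
    then show "range Q = Y" by (simp add: inj_image_eq_iff[OF f(2)])
  qed
  then have "(INF Q\<in>{Q. projection_onto UNIV Y Q}. operator_norm UNIV N Q) \<le> operator_norm UNIV N Q"
    by (intro INF_lower) simp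
  also have "\<dots> \<le> operator_norm (range f) M P"
    unfolding operator_norm_def
  proof (intro SUP_least)
    fix x assume "x \<in> {x \<in> UNIV. N x \<le> 1}"
    then show "ereal (N (Q x)) \<le> (SUP x\<in>{x \<in> range f. M x \<le> 1}. ereal (M (P x)))"
      by (intro SUP_upper2[of "f x"]) (auto simp: N fQ[symmetric])
  qed
  finally show "(INF Q\<in>{Q. projection_onto UNIV Y Q}. operator_norm UNIV N Q) \<le> operator_norm (range f) M P" .
qed

text \<open>Without a finite spanning set a basis is infinite, so it has enough members to serve as
  images of \<open>Basis\<close>.\<close>

lemma exists_injective_linear_map:
  assumes "\<not> (\<exists>B :: 'v::real_vector set. finite B \<and> span B = UNIV)"
  obtains f :: "'a::euclidean_space \<Rightarrow> 'v::real_vector" where "linear f" "inj f"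
proof -
  obtain B :: "'v set" where B: "independent B" "UNIV \<subseteq> span B"
    by (rule basis_exists[of UNIV])
  then have "span B = UNIV" by (simp add: top.extremum_unique)
  then have "infinite B" using assms by blast
  from infinite_arbitrarily_large[OF this, of "DIM('a)"]
  obtain D where D: "D \<subseteq> B" "finite D" "card D = DIM('a)" by blast
  then obtain h where h: "bij_betw h (Basis :: 'a set) D"
    using finite_same_card_bij[OF finite_Basis D(2)] by metis
  have "independent (h ` Basis)" 
    using h independent_mono[OF B(1) D(1)] by (simp add: bij_betw_def)
  obtain f where f: "linear f" "\<forall>x\<in>Basis. f x = h x"
    using linear_independent_extend[OF independent_Basis, of h] by blast
  have "f ` Basis = h ` Basis" "inj_on f Basis"
    using f(2) h by (auto simp: bij_betw_def inj_on_def)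
  then have "inj_on f (span Basis)"
    using \<open>independent (h ` Basis)\<close> by (intro linear_inj_on_span_independent_image[OF f(1)]) simp_all
  then show ?thesis using f(1) by (intro that) simp_all
qed

section \<open>Equality of the two maximal constants\<close>

theorem theorem1p3:
  fixes r :: nat
  assumes "r \<ge> 1"
    and "CARD('n::finite) \<ge> 2 ^ r * ((r + 1) choose 2)"
    and "\<not> (\<exists>B :: 'v::real_vector set. finite B \<and> span B = UNIV)"
  shows "max_rel_proj_const TYPE('n) r = max_abs_proj_const TYPE('v) r"
proof (rule antisym)
  \<comment> \<open>The universe contains an isometric copy of the sup-normed space, so the
    subspaces of the copy, embedded by the identity, compete in the absolute constant.\<close>
  obtain f :: "real ^ 'n \<Rightarrow> 'v" where f: "linear f" "inj f"
    by (rule exists_injective_linear_map[OF assms(3)])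
  obtain M where M: "normed_space_on (range f) M" "isometric_embedding UNIV infnorm (range f) M f"
    using normed_space_copy[OF normed_space_on_infnorm f] by blast
  show "max_rel_proj_const TYPE('n) r \<le> max_abs_proj_const TYPE('v) r"
    unfolding max_rel_proj_const_def
  proof (intro Sup_least, clarify)
    fix Y :: "(real ^ 'n) set" assume Y: "subspace Y" "r = dim Y"
    have fY: "normed_space_on (f ` Y) M"
      using M(1) linear_subspace_image[OF f(1) Y(1)] by (auto simp: normed_space_on_def)
    have "isometric_embedding (f ` Y) M (range f) M id"
      by (auto simp: isometric_embedding_def linear_map_on_def)
    then have le: "rel_proj_const (id ` f ` Y) (range f) M \<le> abs_proj_const (f ` Y) M"
      unfolding abs_proj_const_def using M(1) by (intro Sup_upper) blast
    have "dim (f ` Y) = dim Y"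
      by (rule dim_image_eq[OF f(1) inj_on_subset[OF f(2)]]) simp
    then have "abs_proj_const (f ` Y) M \<le> max_abs_proj_const TYPE('v) (dim Y)"
      unfolding max_abs_proj_const_def using fY by (intro Sup_upper) blast
    with le show "rel_proj_const Y UNIV infnorm \<le> max_abs_proj_const TYPE('v) (dim Y)"
      using rel_proj_const_image_ge[OF f M(2), of Y] by simp
  qed
next
  have r_le: "r \<le> CARD('n)" using le_two_power_times_choose assms(2) by (rule order_trans)
  show "max_abs_proj_const TYPE('v) r \<le> max_rel_proj_const TYPE('n) r"
  \<comment> \<open>A finite value \<open>L\<close> bounds all energies; infinity is trivial and
    minus infinity is excluded by nonnegativity.\<close>
  proof (cases "max_rel_proj_const TYPE('n) r")
    case (real L)
    obtain K :: "'n set" where K: "card K = r"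
      using obtain_subset_with_card_n[of r "UNIV :: 'n set"] r_le by blast
    have K0: "K \<noteq> {}" using K assms(1) by auto
    \<comment> \<open>The systems are indexed by \<open>'v\<close> because the functionals in
      \<open>rel_proj_const_le\<close> are indexed by the points of a net.\<close>
    have bound: "energy I K a v \<le> L * sum a I"
      if "finite I" "\<And>i. i \<in> I \<Longrightarrow> 0 \<le> a i" "isotropic I K a v"
      for I a and v :: "'v \<Rightarrow> 'n \<Rightarrow> real"
      using that K K0 assms(2) real by (intro energy_le_max_rel_proj_const[where 'n = 'n]) auto
    have "rel_proj_const (T ` Y) X N \<le> ereal L"
      if Y: "normed_space_on Y M" "dim Y = r" and X: "normed_space_on X N" "isometric_embedding Y M X N T"
      for Y X :: "'v set" and M N T
    proof -
      note TY = dim_isometric_image[OF X(1) Y(1) X(2)]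
      obtain B where B: "B \<subseteq> T ` Y" "independent B" "T ` Y \<subseteq> span B" "card B = dim (T ` Y)"
        by (rule basis_exists)
      have "finite B" using B(4) TY(3) Y(2) assms(1) by (intro card_ge_0_finite) simp
      then obtain e where e: "bij_betw e K B"
        using finite_same_card_bij[of K B] B(4) TY(3) Y(2) K by auto
      have eB: "e ` K = B" "inj_on e K" using e by (auto simp: bij_betw_def)
      have "T ` Y = span (e ` K)" unfolding eB using B TY(1) by (simp add: span_subspace)
      moreover have "rel_proj_const (span (e ` K)) X N \<le> ereal L"
        using B(1,2) TY(2) eB by (intro rel_proj_const_le X(1) K0 bound) auto
      ultimately show ?thesis by simp
    qed
    then show ?thesis
      unfolding real max_abs_proj_const_def abs_proj_const_def by (intro Sup_least) (auto intro!: Sup_least)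
  next
    case PInf
    then show ?thesis by simp
  next
    case MInf
    then show ?thesis using max_rel_proj_const_nonneg[OF r_le] by simp
  qed
qed

end
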